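(* Let $k\ge 2$. Let $V_0^{\rm s}$, the group $\hat G_0$ with its action on pairs of $k\times k$ matrices, and the moment map $\hat\mu$ be as defined in the context. The action of $\hat G_0$ on $\hat\mu^{-1}(0)\subset V_0^{\rm s}$ is free and proper, and the symplectic quotient $\hat\mu^{-1}(0)/\hat G_0$ is biholomorphic to the open subset of the Hilbert scheme $(\mathbb{C}^2)^{[k+1]}$ of $k+1$ points in $\mathbb{C}^2$ consisting of $0$-dimensional subschemes not contained in any line.
   Context: $V^{\rm s}$ is the set of pairs $(X,Y)\in\mathrm{Mat}_{k,k}(\mathbb{C})^2$ such that there is no proper subspace $S\subset\mathbb{C}^k$ with $e_1,e_2\in S$, $XS\subset S$, $YS\subset S$. Set $$V_0^{\rm s}=\{(X,Y)\in V^{\rm s}:\ X_{12}=Y_{11},\ X_{22}=Y_{21}\},$$ equipped with the restriction of the symplectic form $\mathrm{tr}\,dX\wedge dY$. $G_0\subset GL(k,\mathbb{C})$ is the group of invertible matrices whose first two columns are $e_1,e_2$. $\hat G_0\subset GL(k+1,\mathbb{C})$ is the group of matrices $\begin{pmatrix}1&u\\0&h\end{pmatrix}$ with $h\in G_0$ and $u=(u_1,\dots,u_k)$ a row vector with $u_1=u_2=0$; it is a semidirect product of $G_0$ and $\mathbb{C}^{k-2}$. It acts on pairs of $k\times k$ matrices by $$(X,Y)\mapsto\bigl(hXh^{-1}-e_1uh^{-1},\ hYh^{-1}-e_2uh^{-1}\bigr).$$ The moment map is $\hat\mu(X,Y)=(\mu(X,Y),\alpha(X,Y))$, where $\mu(X,Y)$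 is the projection of $[X,Y]$ onto its last $k-2$ rows and $\alpha(X,Y)=(X_{32}-Y_{31},\dots,X_{k2}-Y_{k1})^T$. *)

theory Defs
  imports "HOL-Analysis.Analysis" "HOL-Algebra.Group_Action"
    "HOL-Computational_Algebra.Polynomial"
begin

section \<open>Holomorphic functions of several complex variables\<close>

class complex_vector_space = real_vector +
  fixes scaleC :: "complex \<Rightarrow> 'a \<Rightarrow> 'a"
  assumes scaleC_add_right: "scaleC c (x + y) = scaleC c x + scaleC c y"
    and scaleC_add_left: "scaleC (c + d) x = scaleC c x + scaleC d x"
    and scaleC_scaleC: "scaleC c (scaleC d x) = scaleC (c * d) x"
    and scaleC_of_real: "scaleC (complex_of_real r) x = scaleR r x"

instantiation complex :: complex_vector_space
begin
definition scaleC_complex :: "complex \<Rightarrow> complex \<Rightarrow> complex"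
  where "scaleC_complex c z = c * z"
instance
  by standard (simp_all add: scaleC_complex_def algebra_simps scaleR_conv_of_real)
end

instantiation vec :: (complex_vector_space, finite) complex_vector_space
begin
definition scaleC_vec :: "complex \<Rightarrow> 'a ^ 'b \<Rightarrow> 'a ^ 'b"
  where "scaleC_vec c v = (\<chi> i. scaleC c (v $ i))"
instance
  by standard (simp_all add: scaleC_vec_def vec_eq_iff scaleC_add_right scaleC_add_left
      scaleC_scaleC scaleC_of_real)
end

instantiation prod :: (complex_vector_space, complex_vector_space) complex_vector_space
begin
definition scaleC_prod :: "complex \<Rightarrow> 'a \<times> 'b \<Rightarrow> 'a \<times> 'b"
  where "scaleC_prod c v = (scaleC c (fst v), scaleC c (snd v))"
instance
  by standard (simp_all add: scaleC_prod_def prod_eq_iff scaleC_add_right scaleC_add_left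
      scaleC_scaleC scaleC_of_real)
end

definition holo_on :: "('a :: {real_normed_vector, complex_vector_space} \<Rightarrow> complex) \<Rightarrow> 'a set \<Rightarrow> bool"
  where "holo_on F U \<longleftrightarrow> open U \<and>
    (\<forall>z\<in>U. \<exists>D. (F has_derivative D) (at z) \<and> (\<forall>c v. D (scaleC c v) = c * D v))"


section \<open>Complex spaces and biholomorphic maps\<close>

text \<open>
  A (reduced) complex space is recorded by its topology together with its sheaf of holomorphic
  functions: \<open>hol X W\<close> is the set of functions that are holomorphic on the open set \<open>W\<close> (only their
  values on \<open>W\<close> matter).  For complex manifolds these data are equivalent to a holomorphic
  atlas, and a homeomorphism is biholomorphic if and only if it identifies the two sheaves.
\<close>

record 'a complex_space =
  ctop :: "'a topology"
  hol :: "'a set \<Rightarrow> ('a \<Rightarrow> complex) set"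

definition biholomorphism ::
  "'a complex_space \<Rightarrow> 'b complex_space \<Rightarrow> ('a \<Rightarrow> 'b) \<Rightarrow> bool"
  where "biholomorphism X Y \<Phi> \<longleftrightarrow>
    homeomorphic_map (ctop X) (ctop Y) \<Phi> \<and>
    (\<forall>W f. openin (ctop Y) W \<longrightarrow>
       (f \<in> hol Y W \<longleftrightarrow> f \<circ> \<Phi> \<in> hol X {x \<in> topspace (ctop X). \<Phi> x \<in> W}))"

definition biholomorphic :: "'a complex_space \<Rightarrow> 'b complex_space \<Rightarrow> bool"
  where "biholomorphic X Y \<longleftrightarrow> (\<exists>\<Phi>. biholomorphism X Y \<Phi>)"

definition open_subspace :: "'a complex_space \<Rightarrow> 'a set \<Rightarrow> 'a complex_space"
  where "open_subspace X U = \<lparr>ctop = subtopology (ctop X) U, hol = hol X\<rparr>"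

text \<open>
  The structure induced on \<open>S\<close> by an injective map \<open>\<kappa>\<close> into a complex vector space: the holomorphic
  functions are those which locally are restrictions of holomorphic functions on open subsets of
  the vector space.
\<close>

definition induced_hol ::
  "('a \<Rightarrow> 'v :: {real_normed_vector, complex_vector_space}) \<Rightarrow> 'a set \<Rightarrow> ('a \<Rightarrow> complex) set"
  where "induced_hol \<kappa> W =
    {f. \<forall>z\<in>W. \<exists>U F. \<kappa> z \<in> U \<and> holo_on F U \<and> (\<forall>w\<in>W. \<kappa> w \<in> U \<longrightarrow> f w = F (\<kappa> w))}"

definition embedded_space ::
  "'v :: {real_normed_vector, complex_vector_space} set \<Rightarrow> 'v complex_space"
  where "embedded_space S = \<lparr>ctop = top_of_set S, hol = induced_hol id\<rparr>"

text \<open>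
  The quotient by a surjection \<open>\<pi>\<close>: quotient topology, and a function is holomorphic if and only if
  its pullback is.  For the orbit map of a free and proper holomorphic action on a complex
  manifold this is the usual complex structure on the orbit space.
\<close>

definition quotient_space :: "'a complex_space \<Rightarrow> ('a \<Rightarrow> 'b) \<Rightarrow> 'b complex_space"
  where "quotient_space X \<pi> =
    \<lparr>ctop = topology (\<lambda>W. W \<subseteq> \<pi> ` topspace (ctop X) \<and>
              openin (ctop X) {x \<in> topspace (ctop X). \<pi> x \<in> W}),
     hol = (\<lambda>W. {f. f \<circ> \<pi> \<in> hol X {x \<in> topspace (ctop X). \<pi> x \<in> W}})\<rparr>"

lemma openin_quotient_space:
  "openin (ctop (quotient_space X \<pi>)) W \<longleftrightarrow>
     W \<subseteq> \<pi> ` topspace (ctop X) \<and> openin (ctop X) {x \<in> topspace (ctop X). \<pi> x \<in> W}"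
proof -
  have "istopology (\<lambda>W. W \<subseteq> \<pi> ` topspace (ctop X) \<and>
          openin (ctop X) {x \<in> topspace (ctop X). \<pi> x \<in> W})" (is "istopology ?P")
    unfolding istopology_def
  proof (intro conjI allI impI)
    fix S T assume S: "?P S" and T: "?P T"
    have "{x \<in> topspace (ctop X). \<pi> x \<in> S \<inter> T} =
        {x \<in> topspace (ctop X). \<pi> x \<in> S} \<inter> {x \<in> topspace (ctop X). \<pi> x \<in> T}" by auto
    then show "openin (ctop X) {x \<in> topspace (ctop X). \<pi> x \<in> S \<inter> T}"
      using S T by (simp add: openin_Int)
    show "S \<inter> T \<subseteq> \<pi> ` topspace (ctop X)" using S by blast
  next
    fix K assume K: "\<forall>S\<in>K. ?P S"
    have "{x \<in> topspace (ctop X). \<pi> x \<in> \<Union>K} = (\<Union>S\<in>K. {x \<in> topspace (ctop X). \<pi> x \<in> S})" by auto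
    then show "openin (ctop X) {x \<in> topspace (ctop X). \<pi> x \<in> \<Union>K}"
      using K by (auto intro!: openin_Union)
    show "\<Union>K \<subseteq> \<pi> ` topspace (ctop X)" using K by blast
  qed
  then show ?thesis by (simp add: quotient_space_def topology_inverse')
qed


section \<open>The Hilbert scheme of points in the plane\<close>

text \<open>
  The ring \<open>\<complex>[x, y]\<close> is \<open>complex poly poly\<close>, with \<open>x\<close> the inner and \<open>y\<close> the outer variable.
  A \<open>0\<close>-dimensional subscheme of length \<open>n\<close> of the plane is an ideal \<open>I\<close> with
  \<open>dim \<complex>[x, y]/I = n\<close>; the number \<open>n\<close> is carried by an index type with \<open>n\<close> elements.
\<close>

type_synonym poly2 = "complex poly poly"

definition varx :: poly2 where "varx = [:[:0, 1:]:]"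

definition vary :: poly2 where "vary = [:0, 1:]"

definition const2 :: "complex \<Rightarrow> poly2" where "const2 c = [:[:c:]:]"

definition poly2_ideal :: "poly2 set \<Rightarrow> bool"
  where "poly2_ideal I \<longleftrightarrow> 0 \<in> I \<and> (\<forall>f\<in>I. \<forall>g\<in>I. f + g \<in> I) \<and> (\<forall>f. \<forall>g\<in>I. f * g \<in> I)"

definition basis_mod :: "poly2 set \<Rightarrow> ('n :: finite \<Rightarrow> poly2) \<Rightarrow> bool"
  where "basis_mod I b \<longleftrightarrow> (\<forall>f. \<exists>!c :: complex ^ 'n. f - (\<Sum>j\<in>UNIV. const2 (c $ j) * b j) \<in> I)"

definition coords_mod :: "poly2 set \<Rightarrow> ('n :: finite \<Rightarrow> poly2) \<Rightarrow> poly2 \<Rightarrow> complex ^ 'n"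
  where "coords_mod I b f = (THE c. f - (\<Sum>j\<in>UNIV. const2 (c $ j) * b j) \<in> I)"

definition hilb_points :: "'n :: finite itself \<Rightarrow> poly2 set set"
  where "hilb_points _ = {I. poly2_ideal I \<and> (\<exists>b :: 'n \<Rightarrow> poly2. basis_mod I b)}"

text \<open>
  The standard affine charts: for an \<open>n\<close>-tuple \<open>b\<close> of polynomials, \<open>hilb_domain b\<close> is the open set of
  ideals modulo which \<open>b\<close> is a basis.  It embeds into affine space through the structure
  constants of the quotient algebra, i.e. the matrices of multiplication by \<open>x\<close> and \<open>y\<close> and the
  coordinates of \<open>1\<close> with respect to \<open>b\<close>.  The Hilbert scheme is glued from these charts.
  As it is smooth, hence reduced, its complex structure is determined by this.
\<close>

definition hilb_domain :: "('n :: finite \<Rightarrow> poly2) \<Rightarrow> poly2 set set"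
  where "hilb_domain b = {I. poly2_ideal I \<and> basis_mod I b}"

definition hilb_chart ::
  "('n :: finite \<Rightarrow> poly2) \<Rightarrow> poly2 set \<Rightarrow> (complex^'n^'n) \<times> (complex^'n^'n) \<times> (complex^'n)"
  where "hilb_chart b I =
    ((\<chi> i j. coords_mod I b (varx * b j) $ i),
     (\<chi> i j. coords_mod I b (vary * b j) $ i),
     coords_mod I b 1)"

definition hilb :: "'n :: finite itself \<Rightarrow> poly2 set complex_space"
  where "hilb _ =
    \<lparr>ctop = topology (\<lambda>W. W \<subseteq> hilb_points TYPE('n) \<and> (\<forall>b :: 'n \<Rightarrow> poly2.
        openin (pullback_topology (hilb_domain b) (hilb_chart b) euclidean) (W \<inter> hilb_domain b))),
     hol = (\<lambda>W. {f. \<forall>b :: 'n \<Rightarrow> poly2. f \<in> induced_hol (hilb_chart b) (W \<inter> hilb_domain b)})\<rparr>"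

lemma openin_hilb:
  "openin (ctop (hilb TYPE('n :: finite))) W \<longleftrightarrow>
     W \<subseteq> hilb_points TYPE('n) \<and> (\<forall>b :: 'n \<Rightarrow> poly2.
       openin (pullback_topology (hilb_domain b) (hilb_chart b) euclidean) (W \<inter> hilb_domain b))"
proof -
  have "istopology (\<lambda>W. W \<subseteq> hilb_points TYPE('n) \<and> (\<forall>b :: 'n \<Rightarrow> poly2.
      openin (pullback_topology (hilb_domain b) (hilb_chart b) euclidean) (W \<inter> hilb_domain b)))"
    (is "istopology ?P")
    unfolding istopology_def
  proof (intro conjI allI impI)
    fix S T and b :: "'n \<Rightarrow> poly2" assume S: "?P S" and T: "?P T"
    have "S \<inter> T \<inter> hilb_domain b = (S \<inter> hilb_domain b) \<inter> (T \<inter> hilb_domain b)" by auto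
    then show "openin (pullback_topology (hilb_domain b) (hilb_chart b) euclidean)
        (S \<inter> T \<inter> hilb_domain b)"
      using S T by (simp add: openin_Int)
  next
    fix S T assume "?P S" "?P T"
    then show "S \<inter> T \<subseteq> hilb_points TYPE('n)" by blast
  next
    fix K and b :: "'n \<Rightarrow> poly2" assume K: "\<forall>S\<in>K. ?P S"
    have "\<Union>K \<inter> hilb_domain b = (\<Union>S\<in>K. S \<inter> hilb_domain b)" by auto
    then show "openin (pullback_topology (hilb_domain b) (hilb_chart b) euclidean)
        (\<Union>K \<inter> hilb_domain b)"
      using K by (simp only:) (rule openin_Union, blast)
  next
    fix K assume "\<forall>S\<in>K. ?P S"
    then show "\<Union>K \<subseteq> hilb_points TYPE('n)" by blast
  qed
  then show ?thesis by (simp add: hilb_def topology_inverse')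
qed

definition line_poly :: "complex \<Rightarrow> complex \<Rightarrow> complex \<Rightarrow> poly2"
  where "line_poly a b c = const2 a * varx + const2 b * vary + const2 c"

text \<open>A subscheme lies in a line if and only if its ideal contains the ideal of the line.\<close>

definition contained_in_line :: "poly2 set \<Rightarrow> bool"
  where "contained_in_line I \<longleftrightarrow>
    (\<exists>a b c. (a, b) \<noteq> (0, 0) \<and> {g * line_poly a b c | g. True} \<subseteq> I)"

definition hilb_nonlinear :: "'n :: finite itself \<Rightarrow> poly2 set set"
  where "hilb_nonlinear _ = {I \<in> hilb_points TYPE('n). \<not> contained_in_line I}"


section \<open>The group action\<close>

text \<open>
  Matrices of size \<open>k\<close> are indexed by a type \<open>'k\<close> with \<open>k\<close> elements; the distinct indices \<open>p\<close>, \<open>q\<close> play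
  the roles of 1 and 2.  Matrices of size \<open>k + 1\<close> are indexed by \<open>'k option\<close>, with
  \<open>None\<close> the additional first index.
\<close>

type_synonym 'k matpair = "(complex^'k^'k) \<times> (complex^'k^'k)"

definition Vs :: "'k :: finite \<Rightarrow> 'k \<Rightarrow> 'k matpair set"
  where "Vs p q = {(X, Y). \<not> (\<exists>S. vec.subspace S \<and> S \<noteq> UNIV \<and> axis p 1 \<in> S \<and> axis q 1 \<in> S \<and>
    (\<forall>v\<in>S. X *v v \<in> S) \<and> (\<forall>v\<in>S. Y *v v \<in> S))}"

definition V0s :: "'k :: finite \<Rightarrow> 'k \<Rightarrow> 'k matpair set"
  where "V0s p q = {(X, Y) \<in> Vs p q. X $ p $ q = Y $ p $ p \<and> X $ q $ q = Y $ q $ p}"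

definition G0 :: "'k :: finite \<Rightarrow> 'k \<Rightarrow> (complex^'k^'k) set"
  where "G0 p q = {h. invertible h \<and> column p h = axis p 1 \<and> column q h = axis q 1}"

definition block_mat :: "complex^'k \<Rightarrow> complex^'k^'k \<Rightarrow> complex^('k :: finite option)^('k option)"
  where "block_mat u h = (\<chi> i j. case i of
      None \<Rightarrow> (case j of None \<Rightarrow> 1 | Some j' \<Rightarrow> u $ j')
    | Some i' \<Rightarrow> (case j of None \<Rightarrow> 0 | Some j' \<Rightarrow> h $ i' $ j'))"

definition hatG0 :: "'k :: finite \<Rightarrow> 'k \<Rightarrow> (complex^('k option)^('k option)) monoid"
  where "hatG0 p q =
    \<lparr>carrier = {block_mat u h | u h. h \<in> G0 p q \<and> u $ p = 0 \<and> u $ q = 0},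
     mult = (**), one = mat 1\<rparr>"

definition row_part :: "complex^('k :: finite option)^('k option) \<Rightarrow> complex^'k"
  where "row_part g = (\<chi> j. g $ None $ Some j)"

definition mat_part :: "complex^('k :: finite option)^('k option) \<Rightarrow> complex^'k^'k"
  where "mat_part g = (\<chi> i j. g $ Some i $ Some j)"

definition outer :: "complex^'k \<Rightarrow> complex^'k \<Rightarrow> complex^'k^('k :: finite)"
  where "outer v w = (\<chi> i j. v $ i * w $ j)"

definition hat_act ::
  "'k :: finite \<Rightarrow> 'k \<Rightarrow> complex^('k option)^('k option) \<Rightarrow> 'k matpair \<Rightarrow> 'k matpair"
  where "hat_act p q g = (\<lambda>(X, Y).
    let h = mat_part g; h' = matrix_inv h; u = row_part g in
      (h ** X ** h' - outer (axis p 1) (u v* h'),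
       h ** Y ** h' - outer (axis q 1) (u v* h')))"

text \<open>The values of \<open>\<mu>\<close> and \<open>\<alpha>\<close> have only \<open>k - 2\<close> rows; they are padded by zero in rows \<open>p\<close> and \<open>q\<close>.\<close>

definition mu :: "'k :: finite \<Rightarrow> 'k \<Rightarrow> 'k matpair \<Rightarrow> complex^'k^'k"
  where "mu p q = (\<lambda>(X, Y). \<chi> i. if i = p \<or> i = q then 0 else (X ** Y - Y ** X) $ i)"

definition alpha :: "'k :: finite \<Rightarrow> 'k \<Rightarrow> 'k matpair \<Rightarrow> complex^'k"
  where "alpha p q = (\<lambda>(X, Y). \<chi> i. if i = p \<or> i = q then 0 else X $ i $ q - Y $ i $ p)"

definition hat_mu :: "'k :: finite \<Rightarrow> 'k \<Rightarrow> 'k matpair \<Rightarrow> (complex^'k^'k) \<times> (complex^'k)"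
  where "hat_mu p q z = (mu p q z, alpha p q z)"

definition level_set :: "'k :: finite \<Rightarrow> 'k \<Rightarrow> 'k matpair set"
  where "level_set p q = {z \<in> V0s p q. hat_mu p q z = 0}"

definition level_act ::
  "'k :: finite \<Rightarrow> 'k \<Rightarrow> complex^('k option)^('k option) \<Rightarrow> 'k matpair \<Rightarrow> 'k matpair"
  where "level_act p q g = restrict (hat_act p q g) (level_set p q)"

text \<open>The points of the symplectic quotient are the orbits in the zero level set.\<close>

definition symplectic_quotient :: "'k :: finite \<Rightarrow> 'k \<Rightarrow> 'k matpair set complex_space"
  where "symplectic_quotient p q =
    quotient_space (embedded_space (level_set p q)) (orbit (hatG0 p q) (level_act p q))"

definition free_action :: "('g, 'm) monoid_scheme \<Rightarrow> 'a set \<Rightarrow> ('g \<Rightarrow> 'a \<Rightarrow> 'a) \<Rightarrow> bool"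
  where "free_action G E \<phi> \<longleftrightarrow> (\<forall>z\<in>E. stabilizer G \<phi> z = {\<one>\<^bsub>G\<^esub>})"

text \<open>The library's \<^const>\<open>proper_map\<close> does not include continuity, so it is required separately.\<close>

definition proper_action ::
  "('g :: topological_space, 'm) monoid_scheme \<Rightarrow> 'a :: topological_space set \<Rightarrow>
    ('g \<Rightarrow> 'a \<Rightarrow> 'a) \<Rightarrow> bool"
  where "proper_action G E \<phi> \<longleftrightarrow>
    (let S = prod_topology (top_of_set (carrier G)) (top_of_set E);
         T = prod_topology (top_of_set E) (top_of_set E);
         \<theta> = (\<lambda>(g, z). (\<phi> g z, z))
     in continuous_map S T \<theta> \<and> proper_map S T \<theta>)"

end

theory Submission
  imports Defs
begin

text \<open>
  A point of the Hilbert scheme is an ideal \<open>I\<close> of finite colength.  Choosing a basis of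
  \<open>\<complex>[x, y]/I\<close> turns it into a triple \<open>(A, B, v)\<close>: the commuting matrices of multiplication by \<open>x\<close> and
  \<open>y\<close>, and the cyclic vector given by the class of \<open>1\<close>.  Two such triples define the same ideal exactly
  when they are conjugate, and the conjugating matrix is unique because \<open>v\<close> is cyclic.  The subscheme
  lies in no line exactly when \<open>1, x, y\<close> are linearly independent modulo \<open>I\<close>.  Then the basis can be
  chosen to begin with \<open>1, x, y\<close>; what is left of the freedom in the choice is the group of
  invertible matrices fixing the three basis vectors \<open>e\<^sub>0, e\<^sub>p, e\<^sub>q\<close>, which is
  \<open>hatG0\<close>.  So the non-linear part of the Hilbert scheme is the quotient of
  \<open>commuting_pairs\<close> by conjugation with this group.

  In such a basis \<open>A\<close> and \<open>B\<close> have first columns \<open>e\<^sub>p\<close> and \<open>e\<^sub>q\<close>.  Deleting the first row and column leaves a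
  pair \<open>(X, Y)\<close> of matrices of size \<open>k\<close>, and most entries of \<open>AB = BA\<close> say that \<open>(X, Y)\<close>
  lies in the level set, with the deleted rows being, up to sign, two rows of \<open>[X, Y]\<close>.  Conversely a point of the
  level set extends to \<open>(A, B)\<close> by these rows.  The one part of the commutator not
  controlled by the equations is its first row, so \<open>[A, B]\<close> has rank at most one with image spanned by the
  cyclic vector; a trace computation (\<open>rank_one_commutator_eq_0\<close>) shows that it vanishes.  Hence the level set
  is \<open>commuting_pairs\<close>, and the action of \<open>hatG0\<close> becomes conjugation (\<open>hat_act_eq_conj\<close>).

  Freeness is the uniqueness of the conjugating matrix.  Properness follows from a formula for it:
  for polynomials \<open>b\<close> that form a basis of the quotient, let \<open>P z\<close> be the matrix with columns
  \<open>b\<^sub>j(A, B) e\<^sub>0\<close>; then \<open>P (g z) = g P z\<close>, so \<open>g\<close> depends continuously on \<open>z\<close> and \<open>g z\<close>.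
  The same matrix expresses the charts of the Hilbert scheme as holomorphic functions on the level set
  (\<open>chart_map\<close>), while completing \<open>v, Av, Bv\<close> by constant vectors to a basis gives holomorphic local
  sections in the other direction (\<open>slice_map\<close>).  Together they identify topologies and holomorphic
  functions.
\<close>

section \<open>Matrices and vectors\<close>

lemma matrix_vector_smult: "A *v (c *s (v :: complex^'n)) = c *s (A *v v)"
  by (simp add: matrix_vector_mult_def vec_eq_iff sum_distrib_left algebra_simps)

lemma matrix_inv_left: "invertible (A :: complex^'n^'n) \<Longrightarrow> matrix_inv A ** A = mat 1"
  and matrix_inv_right: "invertible (A :: complex^'n^'n) \<Longrightarrow> A ** matrix_inv A = mat 1"
  unfolding invertible_def matrix_inv_def by (metis (mono_tags, lifting) someI_ex)+

lemma matrix_inv_cancel_left: "invertible (A :: complex^'n^'n) \<Longrightarrow> matrix_inv A *v (A *v v) = v"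
  and matrix_inv_cancel_right: "invertible (A :: complex^'n^'n) \<Longrightarrow> A *v (matrix_inv A *v v) = v"
  by (simp_all add: matrix_vector_mul_assoc matrix_inv_left matrix_inv_right)

lemma matrix_inv_invertible: "invertible (A :: complex^'n^'n) \<Longrightarrow> invertible (matrix_inv A)"
  by (metis invertible_def matrix_inv_left matrix_inv_right)

lemma matrix_inv_unique: "A ** B = mat 1 \<Longrightarrow> matrix_inv (A :: complex^'n^'n) = B"
proof -
  assume AB: "A ** B = mat 1"
  then have "matrix_inv A ** (A ** B) = matrix_inv A" by simp
  moreover have "invertible A" using AB invertible_right_inverse by blast
  ultimately show ?thesis by (simp add: matrix_mul_assoc matrix_inv_left)
qed

lemma surj_imp_invertible:
  assumes "\<And>w. \<exists>u. (A :: complex^'n^'n) *v u = w"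
  shows "invertible A"
proof -
  have "surj ((*v) A)" using assms by (metis surj_def)
  then show ?thesis using invertible_right_inverse matrix_right_invertible_surjective by blast
qed

lemma mult_axis: "(A :: complex^'n^'m) *v axis j 1 = column j A"
  by (simp add: matrix_vector_mult_def axis_def column_def vec_eq_iff if_distrib cong: if_cong)

lemma mat_eq_axis:
  assumes "\<And>j. (A :: complex^'n^'m) *v axis j 1 = B *v axis j 1"
  shows "A = B"
  using assms unfolding mult_axis by (simp add: column_def vec_eq_iff)

section \<open>Polynomials in a pair of matrices\<close>

text \<open>
  The vector \<open>f(A) v\<close>, by Horner's scheme. The product of the type class on matrices
  is the componentwise one, so \<open>f(A)\<close> is not an instance of polynomial evaluation.
\<close>

definition pact1 :: "complex^'n^'n \<Rightarrow> complex poly \<Rightarrow> complex^'n \<Rightarrow> complex^'n"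
  where "pact1 A f v = fold_coeffs (\<lambda>a w. a *s v + A *v w) f 0"

text \<open>
  The same Horner scheme in \<open>y\<close>. For commuting \<open>A\<close>, \<open>B\<close>
  this makes the vector space a module over \<open>\<complex>[x, y]\<close>.
\<close>

definition pact :: "complex^'n^'n \<Rightarrow> complex^'n^'n \<Rightarrow> poly2 \<Rightarrow> complex^'n \<Rightarrow> complex^'n"
  where "pact A B f v = fold_coeffs (\<lambda>c w. pact1 A c v + B *v w) f 0"

lemma pact1_0 [simp]: "pact1 A 0 v = 0"
  by (simp add: pact1_def)

lemma pact1_pCons [simp]: "pact1 A (pCons a f) v = a *s v + A *v pact1 A f v"
  by (cases "a = 0 \<and> f = 0") (auto simp: pact1_def)

lemma pact_0 [simp]: "pact A B 0 v = 0"
  by (simp add: pact_def)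

lemma pact_pCons [simp]: "pact A B (pCons c f) v = pact1 A c v + B *v pact A B f v"
  by (cases "c = 0 \<and> f = 0") (auto simp: pact_def)

lemma pact1_add: "pact1 A (f + g) v = pact1 A f v + pact1 A g v"
  by (induction f g rule: poly_induct2) (simp_all add: algebra_simps)

lemma pact_add: "pact A B (f + g) v = pact A B f v + pact A B g v"
  by (induction f g rule: poly_induct2) (simp_all add: algebra_simps pact1_add)

lemma pact1_smult: "pact1 A (smult c f) v = c *s pact1 A f v"
  by (induction f) (simp_all add: vector_add_ldistrib matrix_vector_smult)

lemma pact1_mult: "pact1 A (f * g) v = pact1 A f (pact1 A g v)"
  by (induction f) (simp_all add: pact1_add pact1_smult)

lemma pact1_intertwine: "g ** A = A' ** g \<Longrightarrow> g *v pact1 A f v = pact1 A' f (g *v v)"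
  by (induction f) (simp_all add: algebra_simps matrix_vector_smult matrix_vector_mul_assoc
      flip: matrix_vector_mul_assoc[of A'])

text \<open>
  A matrix intertwining \<open>A\<close>, \<open>B\<close> with \<open>A'\<close>,
  \<open>B'\<close> is a homomorphism of the modules they define.
\<close>

lemma pact_intertwine:
  "g ** A = A' ** g \<Longrightarrow> g ** B = B' ** g \<Longrightarrow> g *v pact A B f v = pact A' B' f (g *v v)"
  by (induction f) (simp_all add: algebra_simps pact1_intertwine matrix_vector_mul_assoc
      flip: matrix_vector_mul_assoc[of B'])

lemma pact1_vec_add: "pact1 A f (v + w) = pact1 A f v + pact1 A f w"
  by (induction f) (simp_all add: algebra_simps vector_add_ldistrib)

lemma pact_smult:
  "A ** B = B ** A \<Longrightarrow> pact A B (smult c g) v = pact1 A c (pact A B g v)"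
proof (induction g)
  case 0
  show ?case by (induction c) auto
next
  case (pCons d g)
  then show ?case by (simp add: pact1_mult pact1_vec_add pact1_intertwine)
qed

text \<open>
  Commutativity is what moves the \<open>x\<close>-coefficients of one factor past the powers of
  \<open>y\<close> of the other.
\<close>

lemma pact_mult:
  "A ** B = B ** A \<Longrightarrow> pact A B (f * g) v = pact A B f (pact A B g v)"
  by (induction f) (simp_all add: pact_add pact_smult)

lemma pact1_1 [simp]: "pact1 A 1 v = v"
  by (simp add: one_pCons)

lemma pact_varx [simp]: "pact A B varx v = A *v v"
  by (simp add: varx_def)

lemma pact_vary [simp]: "pact A B vary v = B *v v"
  by (simp add: vary_def)

lemma pact_const2 [simp]: "pact A B (const2 c) v = c *s v"
  by (simp add: const2_def)

lemma pact_1 [simp]: "pact A B 1 v = v"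
  by (simp add: one_pCons)

lemma pact_const2_mult: "pact A B (const2 c * f) v = c *s pact A B f v"
proof -
  have "const2 c * f = smult [:c:] f" by (simp add: const2_def)
  moreover have "pact A B (smult [:c:] f) v = c *s pact A B f v"
    by (induction f) (simp_all add: pact1_mult vector_add_ldistrib matrix_vector_smult pact1_smult)
  ultimately show ?thesis by simp
qed

lemma pact_minus: "pact A B (- f) v = - pact A B f v"
  using pact_add[of A B f "- f" v] by (simp add: eq_neg_iff_add_eq_0 add.commute)

lemma pact_diff: "pact A B (f - g) v = pact A B f v - pact A B g v"
  using pact_add[of A B f "- g" v] by (simp add: pact_minus)

lemma pact_sum: "pact A B (\<Sum>j\<in>J. f j) v = (\<Sum>j\<in>J. pact A B (f j) v)"
  by (induction J rule: infinite_finite_induct) (auto simp: pact_add)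

definition cyclic :: "complex^'n^'n \<Rightarrow> complex^'n^'n \<Rightarrow> complex^'n \<Rightarrow> bool"
  where "cyclic A B v \<longleftrightarrow> (\<forall>S. vec.subspace S \<longrightarrow> v \<in> S \<longrightarrow>
    (\<forall>u\<in>S. A *v u \<in> S) \<longrightarrow> (\<forall>u\<in>S. B *v u \<in> S) \<longrightarrow> S = UNIV)"

lemma pact1_in_subspace:
  assumes "vec.subspace S" "v \<in> S" "\<forall>u\<in>S. A *v u \<in> S"
  shows "pact1 A f v \<in> S"
  using assms by (induction f) (auto intro: vec.subspace_add vec.subspace_scale vec.subspace_0)

lemma pact_in_subspace:
  assumes "vec.subspace S" "v \<in> S" "\<forall>u\<in>S. A *v u \<in> S" "\<forall>u\<in>S. B *v u \<in> S"
  shows "pact A B f v \<in> S"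
  using assms
  by (induction f) (auto intro: vec.subspace_add vec.subspace_0 pact1_in_subspace)

text \<open>
  The vectors \<open>f(A, B) v\<close> form the smallest invariant subspace containing
  \<open>v\<close>.
\<close>

lemma cyclic_iff_surj:
  assumes "A ** B = B ** A"
  shows "cyclic A B v \<longleftrightarrow> (\<forall>w. \<exists>f. pact A B f v = w)"
proof
  assume cyc: "cyclic A B v"
  define S where "S = range (\<lambda>f. pact A B f v)"
  have mem: "pact A B f v \<in> S" for f unfolding S_def by blast
  have "vec.subspace S"
  proof (rule vec.subspaceI)
    show "0 \<in> S" using mem[of 0] by simp
  next
    fix x y assume "x \<in> S" "y \<in> S"
    then obtain f g where "x = pact A B f v" "y = pact A B g v" unfolding S_def by blast
    then show "x + y \<in> S" using mem[of "f + g"] by (simp add: pact_add)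
  next
    fix c x assume "x \<in> S"
    then obtain f where "x = pact A B f v" unfolding S_def by blast
    then show "c *s x \<in> S" using mem[of "const2 c * f"] by (simp add: pact_const2_mult)
  qed
  moreover have "v \<in> S" using mem[of 1] by simp
  moreover have "A *v pact A B f v \<in> S" "B *v pact A B f v \<in> S" for f
    using mem[of "varx * f"] mem[of "vary * f"] by (simp_all add: pact_mult assms)
  then have "\<And>u. u \<in> S \<Longrightarrow> A *v u \<in> S" "\<And>u. u \<in> S \<Longrightarrow> B *v u \<in> S"
    unfolding S_def by blast+
  ultimately have "S = UNIV" using cyc unfolding cyclic_def by simp
  show "\<forall>w. \<exists>f. pact A B f v = w"
  proof
    fix w
    have "w \<in> S" using \<open>S = UNIV\<close> by simp
    then show "\<exists>f. pact A B f v = w" unfolding S_def by auto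
  qed
next
  assume surj: "\<forall>w. \<exists>f. pact A B f v = w"
  show "cyclic A B v"
    unfolding cyclic_def
  proof (intro allI impI)
    fix S assume S: "vec.subspace S" "v \<in> S" "\<forall>u\<in>S. A *v u \<in> S" "\<forall>u\<in>S. B *v u \<in> S"
    have "w \<in> S" for w using surj pact_in_subspace[OF S] by metis
    then show "S = UNIV" by blast
  qed
qed

lemma cyclic_obtain:
  assumes "A ** B = B ** A" "cyclic A B v"
  obtains f where "pact A B f v = w"
  using assms cyclic_iff_surj by blast

definition annih :: "complex^'n^'n \<Rightarrow> complex^'n^'n \<Rightarrow> complex^'n \<Rightarrow> poly2 set"
  where "annih A B v = {f. pact A B f v = 0}"

text \<open>
  The columns are the vectors \<open>b\<^sub>j(A, B) v\<close>.
\<close>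

definition frame :: "complex^'n^'n \<Rightarrow> complex^'n^'n \<Rightarrow> complex^'n \<Rightarrow> ('n \<Rightarrow> poly2) \<Rightarrow> complex^'n^'n"
  where "frame A B v b = (\<chi> i j. pact A B (b j) v $ i)"

lemma frame_mult: "frame A B v b *v c = (\<Sum>j\<in>UNIV. c $ j *s pact A B (b j) v)"
  by (simp add: frame_def matrix_vector_mult_def vec_eq_iff mult.commute)

lemma frame_axis: "frame A B v b *v axis j 1 = pact A B (b j) v"
  by (simp add: mult_axis frame_def column_def vec_eq_iff)

lemma pact_combination:
  "pact A B (\<Sum>j\<in>UNIV. const2 (c $ j) * b j) v = frame A B v b *v c"
  by (simp add: pact_sum pact_const2_mult frame_mult)

lemma poly2_ideal_annih:
  assumes "A ** B = B ** A"
  shows "poly2_ideal (annih A B v)"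
proof -
  have "pact1 A f 0 = 0" for f by (induction f) auto
  then have "pact A B f 0 = 0" for f by (induction f) auto
  then show ?thesis by (auto simp: poly2_ideal_def annih_def pact_add pact_mult assms)
qed

lemma mem_annih_diff:
  "f - (\<Sum>j\<in>UNIV. const2 (c $ j) * b j) \<in> annih A B v \<longleftrightarrow> frame A B v b *v c = pact A B f v"
  by (auto simp: annih_def pact_diff pact_combination)

text \<open>
  Evaluation at \<open>v\<close> identifies the quotient ring by the annihilator with the vector
  space, and takes \<open>b\<close> to the columns of the frame.
\<close>

lemma basis_mod_annih_iff:
  assumes "A ** B = B ** A" "cyclic A B v"
  shows "basis_mod (annih A B v) b \<longleftrightarrow> invertible (frame A B v b)"
proof
  assume "basis_mod (annih A B v) b"
  then have "\<exists>c. frame A B v b *v c = pact A B f v" for f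
    unfolding basis_mod_def mem_annih_diff by (metis)
  then show "invertible (frame A B v b)"
    using assms cyclic_iff_surj by (metis surj_imp_invertible)
next
  assume "invertible (frame A B v b)"
  then show "basis_mod (annih A B v) b"
    unfolding basis_mod_def mem_annih_diff
    by (metis matrix_inv_cancel_left matrix_inv_cancel_right)
qed

lemma coords_mod_annih:
  assumes "invertible (frame A B v b)"
  shows "coords_mod (annih A B v) b f = matrix_inv (frame A B v b) *v pact A B f v"
  unfolding coords_mod_def mem_annih_diff
proof (rule the_equality)
  show "frame A B v b *v (matrix_inv (frame A B v b) *v pact A B f v) = pact A B f v"
    by (rule matrix_inv_cancel_right[OF assms])
  show "c = matrix_inv (frame A B v b) *v pact A B f v" if "frame A B v b *v c = pact A B f v" for c
    using matrix_inv_cancel_left[OF assms, of c] that by simp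
qed

lemma exists_frame:
  fixes v :: "complex^'n::finite"
  assumes "A ** B = B ** A" "cyclic A B v"
  obtains b :: "'n \<Rightarrow> poly2" where "invertible (frame A B v b)"
proof -
  have "\<forall>j. \<exists>f. pact A B f v = axis j 1" using assms cyclic_iff_surj by blast
  then obtain b where "\<And>j. pact A B (b j) v = axis j 1" by metis
  then have "frame A B v b = mat 1" by (intro mat_eq_axis) (simp add: frame_axis)
  then show ?thesis using that[of b] by (metis invertible_def matrix_mul_lid)
qed

definition conj_mat :: "complex^'n^'n \<Rightarrow> complex^'n^'n \<Rightarrow> complex^'n^'n"
  where "conj_mat g A = g ** A ** matrix_inv g"

lemma conj_mat_intertwine: "invertible g \<Longrightarrow> g ** A = conj_mat g A ** g"
  by (simp add: conj_mat_def matrix_inv_left flip: matrix_mul_assoc)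

lemma conj_mat_eqI:
  assumes "invertible g" "g ** A = A' ** g"
  shows "conj_mat g A = A'"
  by (simp add: conj_mat_def assms(2) matrix_inv_right[OF assms(1)] flip: matrix_mul_assoc)

lemma conj_mat_times:
  assumes "invertible g"
  shows "conj_mat g A ** conj_mat g B = conj_mat g (A ** B)"
proof (rule conj_mat_eqI[OF assms, symmetric])
  show "g ** (A ** B) = conj_mat g A ** conj_mat g B ** g"
    by (metis conj_mat_intertwine[OF assms, of A] conj_mat_intertwine[OF assms, of B] matrix_mul_assoc[of g A B]
       matrix_mul_assoc[of "conj_mat g A" g B] matrix_mul_assoc[of "conj_mat g A" "conj_mat g B" g])
qed

lemma conj_mat_mult:
  assumes "invertible g" "invertible h"
  shows "conj_mat (g ** h) A = conj_mat g (conj_mat h A)"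
proof (rule conj_mat_eqI)
  show "g ** h ** A = conj_mat g (conj_mat h A) ** (g ** h)"
    by (simp add: matrix_mul_assoc conj_mat_intertwine[OF assms(1), symmetric])
       (simp add: conj_mat_intertwine[OF assms(2), symmetric] flip: matrix_mul_assoc)
qed (simp add: assms invertible_mult)

lemma conj_mat_1: "conj_mat (mat 1) A = A"
  by (rule conj_mat_eqI) (auto simp: invertible_def)

lemma cyclic_conj:
  assumes g: "invertible g" and c: "A ** B = B ** A" "cyclic A B v"
  shows "cyclic (conj_mat g A) (conj_mat g B) (g *v v)"
proof -
  have "\<exists>f. pact (conj_mat g A) (conj_mat g B) f (g *v v) = w" for w
  proof -
    obtain f where "pact A B f v = matrix_inv g *v w"
      using cyclic_obtain c by blast
    then have "pact (conj_mat g A) (conj_mat g B) f (g *v v) = w"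
      using pact_intertwine[OF conj_mat_intertwine[OF g] conj_mat_intertwine[OF g], of A B f v]
      by (simp add: matrix_inv_cancel_right g)
    then show ?thesis by blast
  qed
  moreover have "conj_mat g A ** conj_mat g B = conj_mat g B ** conj_mat g A"
    by (simp add: conj_mat_times g c)
  ultimately show ?thesis using cyclic_iff_surj by blast
qed

lemma annih_conj:
  assumes "invertible g"
  shows "annih (conj_mat g A) (conj_mat g B) (g *v v) = annih A B v"
proof -
  have "pact (conj_mat g A) (conj_mat g B) f (g *v v) = g *v pact A B f v" for f
    by (simp add: pact_intertwine conj_mat_intertwine assms)
  moreover have "g *v u = 0 \<longleftrightarrow> u = 0" for u
    by (metis assms matrix_inv_cancel_left matrix_vector_mult_0_right)
  ultimately show ?thesis by (simp add: annih_def)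
qed

text \<open>
  A module homomorphism is determined by its value on a generator.
\<close>

lemma intertwiner_unique:
  assumes "cyclic A B v" "A ** B = B ** A" "g ** A = A' ** g" "g ** B = B' ** g"
    "h ** A = A' ** h" "h ** B = B' ** h" "g *v v = h *v v"
  shows "g = h"
proof (rule mat_eq_axis)
  fix j
  obtain f where f: "pact A B f v = axis j 1"
      using cyclic_obtain assms by blast
  show "g *v axis j 1 = h *v axis j 1"
    using pact_intertwine[OF assms(3,4), of f v] pact_intertwine[OF assms(5,6), of f v] f assms(7)
    by simp
qed

text \<open>
  Both vector spaces are the quotient of \<open>\<complex>[x, y]\<close> by the common
  annihilator. In coordinates with respect to a common basis \<open>b\<close> of this quotient,
  the resulting isomorphism is the quotient of the two frames.
\<close>

lemma annih_eq_imp_conj: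
  assumes c: "A ** B = B ** A" "cyclic A B v" and c': "A' ** B' = B' ** A'" "cyclic A' B' v'"
    and eq: "annih A B v = annih A' B' v'"
  obtains g where "invertible g" "A' = conj_mat g A" "B' = conj_mat g B" "v' = g *v v"
proof -
  obtain b where P: "invertible (frame A B v b)" using exists_frame[OF c] .
  then have P': "invertible (frame A' B' v' b)"
    using basis_mod_annih_iff[OF c] basis_mod_annih_iff[OF c'] eq by simp
  \<comment> \<open>the matrix taking \<open>f(A, B) v\<close> to \<open>f(A', B') v'\<close> for every polynomial \<open>f\<close>\<close>
  define g where "g = frame A' B' v' b ** matrix_inv (frame A B v b)"
  have g: "invertible g" unfolding g_def by (simp add: P P' invertible_mult matrix_inv_invertible)
  have key: "g *v pact A B f v = pact A' B' f v'" for f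
  proof -
    have "matrix_inv (frame A B v b) *v pact A B f v =
        matrix_inv (frame A' B' v' b) *v pact A' B' f v'"
      using coords_mod_annih[OF P, of f] coords_mod_annih[OF P', of f] eq by simp
    then show ?thesis
      by (simp add: g_def matrix_inv_cancel_right[OF P'] flip: matrix_vector_mul_assoc)
  qed
  have "g ** A = A' ** g"
  proof (rule mat_eq_axis)
    fix j
    obtain f where f: "pact A B f v = axis j 1"
      using cyclic_obtain c by blast
    then show "g ** A *v axis j 1 = A' ** g *v axis j 1"
      using key[of "varx * f"] key[of f] by (simp add: pact_mult c c' flip: matrix_vector_mul_assoc)
  qed
  moreover have "g ** B = B' ** g"
  proof (rule mat_eq_axis)
    fix j
    obtain f where f: "pact A B f v = axis j 1"
      using cyclic_obtain c by blast
    then show "g ** B *v axis j 1 = B' ** g *v axis j 1"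
      using key[of "vary * f"] key[of f] by (simp add: pact_mult c c' flip: matrix_vector_mul_assoc)
  qed
  moreover have "v' = g *v v" using key[of 1] by simp
  ultimately show ?thesis using that g conj_mat_eqI by metis
qed

text \<open>
  In the basis \<open>b\<close> the structure constants are those of the given triple after the
  change of basis by the frame.
\<close>

lemma hilb_chart_annih:
  assumes "A ** B = B ** A" and P: "invertible (frame A B v b)"
  defines "Q \<equiv> matrix_inv (frame A B v b)"
  shows "hilb_chart b (annih A B v) = (conj_mat Q A, conj_mat Q B, Q *v v)"
proof -
  have Q: "invertible Q" "matrix_inv Q = frame A B v b"
    unfolding Q_def by (simp_all add: P matrix_inv_invertible matrix_inv_unique matrix_inv_left)
  have cols: "(\<chi> i j. c j $ i) *v axis j 1 = c j" for c :: "'a \<Rightarrow> complex^'a" and j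
    by (simp add: mult_axis column_def vec_eq_iff)
  have "(\<chi> i j. coords_mod (annih A B v) b (varx * b j) $ i) = conj_mat Q A"
    by (rule mat_eq_axis) (simp add: cols coords_mod_annih[OF P] pact_mult[OF assms(1)]
        conj_mat_def Q frame_axis flip: matrix_vector_mul_assoc Q_def)
  moreover have "(\<chi> i j. coords_mod (annih A B v) b (vary * b j) $ i) = conj_mat Q B"
    by (rule mat_eq_axis) (simp add: cols coords_mod_annih[OF P] pact_mult[OF assms(1)]
        conj_mat_def Q frame_axis flip: matrix_vector_mul_assoc Q_def)
  ultimately show ?thesis by (simp add: hilb_chart_def coords_mod_annih[OF P] Q_def)
qed

section \<open>Ideals of finite colength and commuting matrices\<close>

lemma const2_add: "const2 (c + d) = const2 c + const2 d"
  and const2_0: "const2 0 = 0"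
  and const2_mult: "const2 (c * d) = const2 c * const2 d"
  by (simp_all add: const2_def one_pCons)

text \<open>
  The chart loses nothing: the coordinates of a polynomial \<open>f\<close> modulo
  \<open>I\<close> are \<open>f(A, B) v\<close>, since this holds for \<open>1\<close> and
  multiplication by \<open>x\<close> and \<open>y\<close> acts on coordinates by \<open>A\<close>
  and \<open>B\<close>. All three conclusions are read off from this formula.
\<close>

lemma hilb_chart_recovers:
  fixes b :: "'n::finite \<Rightarrow> poly2"
  assumes I: "poly2_ideal I" and b: "basis_mod I b" and chart: "hilb_chart b I = (A, B, v)"
  shows "A ** B = B ** A" "cyclic A B v" "annih A B v = I"
proof -
  define lin where "lin c = (\<Sum>j\<in>UNIV. const2 (c $ j) * b j)" for c :: "complex^'n"
  define co where "co = coords_mod I b"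
  have I_add: "f + g \<in> I" if "f \<in> I" "g \<in> I" for f g using I that unfolding poly2_ideal_def by blast
  have I_mult: "f * g \<in> I" if "g \<in> I" for f g using I that unfolding poly2_ideal_def by blast
  have I_0: "0 \<in> I" using I unfolding poly2_ideal_def by blast
  have ex1: "\<exists>!c. f - lin c \<in> I" for f using b unfolding basis_mod_def lin_def by blast
  have co_mem: "f - lin (co f) \<in> I" for f
    using theI'[OF ex1[of f]] unfolding co_def coords_mod_def lin_def .
  have co_eq: "co f = c" if "f - lin c \<in> I" for f c using ex1 co_mem that by blast
  have lin_add: "lin (c + d) = lin c + lin d" for c d
    by (simp add: lin_def const2_add algebra_simps sum.distrib)
  have lin_scale: "lin (a *s c) = const2 a * lin c" for a c
    by (simp add: lin_def const2_mult sum_distrib_left algebra_simps)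
  have co_add: "co (f + g) = co f + co g" for f g
    using I_add[OF co_mem[of f] co_mem[of g]] by (intro co_eq) (simp add: lin_add algebra_simps)
  have co_scale: "co (const2 a * f) = a *s co f" for a f
    using I_mult[OF co_mem[of f], of "const2 a"] by (intro co_eq) (simp add: lin_scale algebra_simps)
  have co_I: "co f = 0" if "f \<in> I" for f
    using that by (intro co_eq) (simp add: lin_def const2_0)
  have co_0_I: "f \<in> I" if "co f = 0" for f
    using co_mem[of f] that by (simp add: lin_def const2_0)
  have co_sum: "co (\<Sum>j\<in>J. f j) = (\<Sum>j\<in>J. co (f j))" for J and f :: "'n \<Rightarrow> poly2"
    by (induction J rule: infinite_finite_induct) (auto simp: co_add co_I I_0)
  have co_lin: "co (lin c) = c" for c by (intro co_eq) (simp add: I_0)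
  \<comment> \<open>multiplication by a polynomial is multiplication by the matrix of its structure constants\<close>
  have co_mult: "co (h * f) = (\<chi> i j. co (h * b j) $ i) *v co f" for h f
  proof -
    have "h * f = h * (f - lin (co f)) + h * lin (co f)" by (simp add: algebra_simps)
    then have "co (h * f) = co (h * lin (co f))"
      using co_add[of "h * (f - lin (co f))"] co_I[OF I_mult[OF co_mem[of f], of h]] by simp
    also have "h * lin (co f) = (\<Sum>j\<in>UNIV. const2 (co f $ j) * (h * b j))"
      by (simp add: lin_def sum_distrib_left algebra_simps)
    also have "co \<dots> = (\<Sum>j\<in>UNIV. co f $ j *s co (h * b j))"
      by (simp add: co_sum co_scale)
    finally show ?thesis by (simp add: matrix_vector_mult_def vec_eq_iff mult.commute)
  qed
  have x: "co (varx * f) = A *v co f" and y: "co (vary * f) = B *v co f" and v: "v = co 1" for f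
    using chart co_mult[of varx f] co_mult[of vary f] by (auto simp: hilb_chart_def co_def)
  have inner: "co [:c:] = pact1 A c v" for c
  proof (induction c)
    case 0 show ?case by (simp add: co_I I_0)
  next
    case (pCons a c)
    have "[:pCons a c:] = const2 a * 1 + varx * [:c:]" by (simp add: const2_def varx_def)
    then have "co [:pCons a c:] = a *s v + A *v co [:c:]" by (simp only: co_add co_scale x) (simp add: v)
    then show ?case using pCons by simp
  qed
  have eval: "co f = pact A B f v" for f
  proof (induction f)
    case 0 show ?case by (simp add: co_I I_0)
  next
    case (pCons c f)
    have "pCons c f = [:c:] + vary * f" by (simp add: vary_def)
    then have "co (pCons c f) = pact1 A c v + B *v co f" by (simp only: co_add y inner)
    then show ?case using pCons by simp
  qed
  have surj: "\<exists>f. pact A B f v = w" for w using co_lin[of w] eval by metis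
  show comm: "A ** B = B ** A"
  proof (rule mat_eq_axis)
    fix j :: 'n
    obtain f where f: "co f = axis j 1" using co_lin by blast
    have "A *v (B *v co f) = co (varx * vary * f)" by (simp only: x y mult.assoc)
    also have "varx * vary * f = vary * varx * f" by (simp add: mult.commute)
    also have "co \<dots> = B *v (A *v co f)" by (simp only: x y mult.assoc)
    finally show "A ** B *v axis j 1 = B ** A *v axis j 1" by (simp add: f flip: matrix_vector_mul_assoc)
  qed
  show "cyclic A B v" using surj cyclic_iff_surj[OF comm] by blast
  show "annih A B v = I"
    unfolding annih_def eval[symmetric] using co_I co_0_I by blast
qed

section \<open>A rank one commutator\<close>

definition mpow :: "complex^'n^'n \<Rightarrow> nat \<Rightarrow> complex^'n^'n"
  where "mpow A n = ((**) A ^^ n) (mat 1)"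

lemma mpow_0 [simp]: "mpow A 0 = mat 1"
  and mpow_Suc: "mpow A (Suc n) = A ** mpow A n"
  by (simp_all add: mpow_def)

lemma mpow_commute: "mpow A n ** A = A ** mpow A n"
  by (induction n) (simp_all add: mpow_Suc flip: matrix_mul_assoc)

lemma outer_mult: "outer v w *v u = (\<Sum>i\<in>UNIV. w $ i * u $ i) *s (v :: complex^'n)"
  by (simp add: outer_def matrix_vector_mult_def vec_eq_iff sum_distrib_left algebra_simps)

lemma trace_mult_outer:
  "trace (M ** outer v w) = (\<Sum>i\<in>UNIV. w $ i * (M *v (v :: complex^'n)) $ i)"
  by (simp add: trace_def outer_def matrix_matrix_mult_def matrix_vector_mult_def
      sum_distrib_left algebra_simps)

lemma trace_sum: "trace (\<Sum>l\<in>L. M l) = (\<Sum>l\<in>L. trace (M l :: complex^'n^'n))"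
  by (induction L rule: infinite_finite_induct) (auto simp: trace_def sum.distrib)

lemma matrix_sum_ldistrib:
  "A ** (\<Sum>l\<in>L. M l) = (\<Sum>l\<in>L. A ** (M l :: complex^'n^'n))"
proof -
  have "A ** (0 :: complex^'n^'n) = 0" by (simp add: matrix_matrix_mult_def vec_eq_iff)
  then show ?thesis by (induction L rule: infinite_finite_induct) (simp_all add: matrix_add_ldistrib)
qed

lemma matrix_diff_ldistrib: "(A :: complex^'n^'n) ** (B - C) = A ** B - A ** C"
  and matrix_diff_rdistrib: "(B - C) ** (A :: complex^'n^'n) = B ** A - C ** A"
  by (simp_all add: matrix_matrix_mult_def vec_eq_iff algebra_simps sum_subtractf)

text \<open>
  The derivation property of the commutator with \<open>A\<close>.
\<close>

lemma commutator_mpow: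
  "A ** mpow B n - mpow B n ** A =
    (\<Sum>l<n. mpow B l ** (A ** B - B ** A) ** mpow B (n - Suc l))"
proof (induction n)
  case 0 show ?case by simp
next
  case (Suc n)
  let ?C = "A ** B - B ** A"
  have "A ** mpow B (Suc n) - mpow B (Suc n) ** A =
      ?C ** mpow B n + B ** (A ** mpow B n - mpow B n ** A)"
    by (simp add: mpow_Suc matrix_diff_ldistrib matrix_diff_rdistrib matrix_mul_assoc)
  also have "\<dots> = mpow B 0 ** ?C ** mpow B n + (\<Sum>l<n. mpow B (Suc l) ** ?C ** mpow B (n - Suc l))"
    by (simp add: Suc matrix_sum_ldistrib mpow_Suc matrix_mul_assoc)
  also have "\<dots> = (\<Sum>l<Suc n. mpow B l ** ?C ** mpow B (Suc n - Suc l))"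
    unfolding sum.lessThan_Suc_shift by simp
  finally show ?case .
qed

text \<open>
  Let \<open>w\<close> also denote the linear form of the row \<open>w\<close>. By induction on
  \<open>a + b\<close>, \<open>w\<close> vanishes on \<open>m a b = A\<^sup>a B\<^sup>b v\<close>.
  If it vanishes on all such vectors of lower degree, then \<open>A\<close> and \<open>B\<close>
  may be exchanged freely when applied to them, because the error term of an exchange is a value
  of \<open>w\<close> there times \<open>v\<close>. The trace of \<open>A\<^sup>a [A,
  B\<^bsup>b+1\<^esup>]\<close> is zero, as \<open>A\<close> commutes with
  \<open>A\<^sup>a\<close>; expanding the commutator into \<open>b + 1\<close> terms containing
  \<open>[A, B]\<close>, each of which contributes \<open>w (m a b)\<close>, gives \<open>(b + 1)
  w (m a b) = 0\<close>. Finally, the vectors \<open>m a b\<close> span an invariant subspace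
  containing \<open>v\<close>, so \<open>w = 0\<close>.
\<close>

lemma rank_one_commutator_eq_0:
  fixes A B :: "complex^'n::finite^'n"
  assumes comm: "A ** B - B ** A = outer v w" and cyc: "cyclic A B v"
  shows "w = 0"
proof -
  define wd where "wd u = (\<Sum>i\<in>UNIV. w $ i * u $ i)" for u :: "complex^'n"
  define m where "m a b = mpow A a *v (mpow B b *v v)" for a b
  have AB: "A *v (B *v u) = B *v (A *v u) + wd u *s v" for u
  proof -
    have "(A ** B - B ** A) *v u = wd u *s v" by (simp add: comm outer_mult wd_def)
    then show ?thesis by (simp add: matrix_vector_mult_diff_rdistrib algebra_simps flip: matrix_vector_mul_assoc)
  qed
  have mA: "A *v m a b = m (Suc a) b" for a b by (simp add: m_def mpow_Suc flip: matrix_vector_mul_assoc)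
  have mB: "B *v m a b = m a (Suc b)" if "\<And>i j. i + j < a + b \<Longrightarrow> wd (m i j) = 0" for a b
    using that
  proof (induction a)
    case 0 show ?case by (simp add: m_def mpow_Suc flip: matrix_vector_mul_assoc)
  next
    case (Suc a)
    have "B *v m (Suc a) b = B *v (A *v m a b)" by (simp add: mA)
    also have "\<dots> = A *v (B *v m a b)" using AB[of "m a b"] Suc.prems[of a b] by simp
    also have "B *v m a b = m a (Suc b)" using Suc by simp
    finally show ?case by (simp add: mA)
  qed
  have zero: "\<forall>a b. a + b < n \<longrightarrow> wd (m a b) = 0" for n
  proof (induction n)
    case 0 show ?case by simp
  next
    case (Suc n)
    have "wd (m a b) = 0" if ab: "a + b = n" for a b
    proof -
      have IH: "wd (m i j) = 0" if "i + j < n" for i j using Suc that by blast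
      have mBpow: "mpow B k *v m a l = m a (l + k)" if "a + l + k \<le> Suc n" for k l
        using that
      proof (induction k)
        case (Suc k)
        have "mpow B (Suc k) *v m a l = B *v m a (l + k)"
          using Suc by (simp add: mpow_Suc flip: matrix_vector_mul_assoc)
        then show ?case using mB[of a "l + k"] IH Suc.prems by simp
      qed simp
      \<comment> \<open>the exponent is one more than in \<open>m a b\<close>, as expanding the commutator uses up one factor \<open>B\<close>\<close>
      let ?b = "Suc b"
      have "trace (mpow A a ** (mpow B l ** outer v w ** mpow B (?b - Suc l))) = wd (m a b)"
        if "l < ?b" for l
      proof -
        have "trace (mpow A a ** (mpow B l ** outer v w ** mpow B (?b - Suc l))) =
            trace ((mpow A a ** mpow B l ** outer v w) ** mpow B (b - l))"
          by (simp add: matrix_mul_assoc)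
        also have "\<dots> = trace ((mpow B (b - l) ** mpow A a ** mpow B l) ** outer v w)"
          by (subst trace_mul_sym) (simp add: matrix_mul_assoc)
        also have "\<dots> = wd (mpow B (b - l) *v m a l)"
          by (simp add: trace_mult_outer wd_def m_def matrix_vector_mul_assoc matrix_mul_assoc)
        also have "\<dots> = wd (m a b)" using mBpow[of l "b - l"] that ab by simp
        finally show ?thesis .
      qed
      then have "of_nat ?b * wd (m a b) =
          trace (mpow A a ** (A ** mpow B ?b - mpow B ?b ** A))"
        unfolding commutator_mpow comm matrix_sum_ldistrib trace_sum by simp
      also have "\<dots> = trace (mpow A a ** A ** mpow B ?b) - trace (mpow A a ** mpow B ?b ** A)"
        by (simp add: matrix_diff_ldistrib trace_sub matrix_mul_assoc)
      also have "trace (mpow A a ** mpow B ?b ** A) = trace (mpow A a ** A ** mpow B ?b)"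
        by (subst trace_mul_sym) (simp add: matrix_mul_assoc mpow_commute)
      finally have "of_nat ?b * wd (m a b) = 0" by simp
      then show ?thesis by (simp del: of_nat_Suc)
    qed
    then show ?case using Suc less_Suc_eq by metis
  qed
  then have zero: "wd (m a b) = 0" for a b by (meson lessI)
  define S where "S = vec.span (range (\<lambda>(a, b). m a b))"
  have gen: "m a b \<in> S" for a b unfolding S_def by (intro vec.span_base) auto
  have sub: "vec.subspace S" unfolding S_def by (rule vec.subspace_span)
  have ind: "P u" if "u \<in> S" "\<And>a b. P (m a b)" "vec.subspace {u. P u}" for P u
  proof -
    have "range (\<lambda>(a, b). m a b) \<subseteq> {u. P u}" using that(2) by auto
    then have "S \<subseteq> {u. P u}" unfolding S_def by (rule vec.span_minimal) (rule that(3))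
    then show "P u" using that(1) by blast
  qed
  have pre: "vec.subspace {u. M *v u \<in> S}" for M :: "complex^'n^'n"
    using sub by (auto simp: vec.subspace_def algebra_simps matrix_vector_smult)
  have "v \<in> S" using gen[of 0 0] by (simp add: m_def)
  moreover have "A *v u \<in> S" if "u \<in> S" for u
    using ind[OF that, of "\<lambda>u. A *v u \<in> S"] gen pre by (simp add: mA)
  moreover have "B *v u \<in> S" if "u \<in> S" for u
    using ind[OF that, of "\<lambda>u. B *v u \<in> S"] gen pre mB zero by simp
  ultimately have "S = UNIV" using cyc sub unfolding cyclic_def by simp
  moreover have "wd (x + y) = wd x + wd y" "wd (c *s x) = c * wd x" "wd 0 = 0" for x y c
    by (simp_all add: wd_def sum.distrib sum_distrib_left algebra_simps)
  then have "vec.subspace {u. wd u = 0}" by (simp add: vec.subspace_def)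
  ultimately have wd0: "wd u = 0" for u using ind[of u "\<lambda>u. wd u = 0"] zero by simp
  have "w $ i = wd (axis i 1)" for i
    by (simp add: wd_def axis_def if_distrib cong: if_cong)
  then show ?thesis by (simp add: vec_eq_iff wd0)
qed

section \<open>The level set as a space of commuting matrices\<close>

abbreviation e0 :: "complex^('k::finite option)" where "e0 \<equiv> axis None 1"

lemma sum_option: "(\<Sum>i\<in>UNIV. f i) = f None + (\<Sum>i\<in>UNIV. f (Some i :: 'k::finite option))"
  by (simp add: UNIV_option_conv sum.reindex)

text \<open>
  By \<open>ext_mat_parts\<close> this is the general shape of a matrix taking
  \<open>e\<^sub>0\<close> to \<open>e\<^sub>p\<close>.
\<close>

definition ext_mat :: "'k::finite \<Rightarrow> complex^'k^'k \<Rightarrow> complex^'k \<Rightarrow> complex^('k option)^('k option)"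
  where "ext_mat p X r = (\<chi> i j. case i of
      None \<Rightarrow> (case j of None \<Rightarrow> 0 | Some j' \<Rightarrow> r $ j')
    | Some i' \<Rightarrow> (case j of None \<Rightarrow> axis p 1 $ i' | Some j' \<Rightarrow> X $ i' $ j'))"

lemma ext_mat_nth [simp]:
  "ext_mat p X r $ None $ None = 0" "ext_mat p X r $ None $ Some j = r $ j"
  "ext_mat p X r $ Some i $ None = axis p 1 $ i" "ext_mat p X r $ Some i $ Some j = X $ i $ j"
  by (simp_all add: ext_mat_def)

lemma mat_eq_option:
  "(A :: complex^('k::finite option)^('k option)) = B \<longleftrightarrow>
    A $ None $ None = B $ None $ None \<and> (\<forall>j. A $ None $ Some j = B $ None $ Some j) \<and>
    (\<forall>i. A $ Some i $ None = B $ Some i $ None) \<and> (\<forall>i j. A $ Some i $ Some j = B $ Some i $ Some j)"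
proof -
  have all: "(\<forall>x :: 'k option. P x) \<longleftrightarrow> P None \<and> (\<forall>x. P (Some x))" for P
    by (metis option.exhaust)
  show ?thesis unfolding vec_eq_iff all by blast
qed

lemma axis_e0_nth [simp]: "(axis None 1 :: complex^('k::finite option)) $ Some i = 0"
  "(axis (Some p) 1 :: complex^('k::finite option)) $ None = 0"
  "(axis (Some p) 1 :: complex^('k::finite option)) $ Some i = axis p 1 $ i"
  by (auto simp: axis_def)

lemma mat_part_nth [simp]: "mat_part A $ i $ j = A $ Some i $ Some j"
  and row_part_nth [simp]: "row_part A $ j = A $ None $ Some j"
  by (simp_all add: mat_part_def row_part_def)

lemma ext_mat_e0: "ext_mat p X r *v e0 = axis (Some p) 1"
  unfolding mult_axis
  by (simp add: column_def vec_eq_iff ext_mat_def axis_def split: option.split)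

lemma ext_mat_parts: "A *v e0 = axis (Some p) 1 \<Longrightarrow> ext_mat p (mat_part A) (row_part A) = A"
  unfolding mult_axis mat_eq_option by (simp add: column_def vec_eq_iff)

lemma mat_part_ext_mat [simp]: "mat_part (ext_mat p X r) = X"
  by (simp add: vec_eq_iff)

lemma ext_mat_times_nth:
  "(ext_mat p X r ** ext_mat q Y s) $ None $ None = r $ q"
  "(ext_mat p X r ** ext_mat q Y s) $ None $ Some j = (r v* Y) $ j"
  "(ext_mat p X r ** ext_mat q Y s) $ Some i $ None = X $ i $ q"
  "(ext_mat p X r ** ext_mat q Y s) $ Some i $ Some j = axis p 1 $ i * s $ j + (X ** Y) $ i $ j"
  by (simp_all add: matrix_matrix_mult_def sum_option vector_matrix_mult_def mult.commute
      axis_def if_distrib cong: if_cong)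

text \<open>
  Modulo \<open>e\<^sub>0\<close> the extended matrices act by \<open>X\<close> and
  \<open>Y\<close>, and they take \<open>e\<^sub>0\<close> to \<open>e\<^sub>p\<close> and
  \<open>e\<^sub>q\<close>. So invariant subspaces containing \<open>e\<^sub>0\<close> correspond
  to subspaces invariant under \<open>X\<close>, \<open>Y\<close> containing
  \<open>e\<^sub>p\<close> and \<open>e\<^sub>q\<close>: stability is cyclicity of
  \<open>e\<^sub>0\<close>.
\<close>

lemma cyclic_ext_mat_iff:
  "cyclic (ext_mat p X r) (ext_mat q Y s) e0 \<longleftrightarrow> (X, Y) \<in> Vs p q"
proof -
  \<comment> \<open>\<open>up\<close> embeds the lower coordinates, \<open>down\<close> is the projection modulo \<open>e\<^sub>0\<close>\<close>
  define up :: "complex^'a \<Rightarrow> complex^('a option)"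
    where "up u = (\<chi> i. case i of None \<Rightarrow> 0 | Some i' \<Rightarrow> u $ i')" for u
  define down :: "complex^('a option) \<Rightarrow> complex^'a" where "down x = (\<chi> i. x $ Some i)" for x
  have down_up: "down (up u) = u" for u by (simp add: up_def down_def vec_eq_iff)
  have split: "x = x $ None *s e0 + up (down x)" for x
    by (auto simp: up_def down_def vec_eq_iff axis_def split: option.split)
  have up_lin: "up (u + w) = up u + up w" "up (c *s u) = c *s up u" "up 0 = 0" for u w c
    by (auto simp: up_def vec_eq_iff split: option.split)
  have down_lin: "down (x + y) = down x + down y" "down (c *s x) = c *s down x" "down 0 = 0" for x y c
    by (auto simp: down_def vec_eq_iff)
  have up_axis: "up (axis i 1) = axis (Some i) 1" for i
    by (auto simp: up_def vec_eq_iff axis_def split: option.split)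
  have down_ext: "down (ext_mat p X r *v x) = x $ None *s axis p 1 + X *v down x" for p X r x
    by (simp add: down_def vec_eq_iff matrix_vector_mult_def sum_option)
  have up_ext: "up (X *v u) = ext_mat p X r *v up u - (\<Sum>j\<in>UNIV. r $ j * u $ j) *s e0" for p X r u
    by (auto simp: up_def vec_eq_iff matrix_vector_mult_def sum_option axis_def split: option.split)
  show ?thesis
  proof
    assume cyc: "cyclic (ext_mat p X r) (ext_mat q Y s) e0"
    have "S = UNIV" if S: "vec.subspace S" "axis p 1 \<in> S" "axis q 1 \<in> S"
      "\<forall>v\<in>S. X *v v \<in> S" "\<forall>v\<in>S. Y *v v \<in> S" for S
    proof -
      have "vec.subspace {x. down x \<in> S}"
        using S(1) by (simp add: vec.subspace_def down_lin)
      moreover have "down e0 \<in> S"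
        using vec.subspace_0[OF S(1)] by (simp add: down_def zero_vec_def)
      moreover have "down (ext_mat p X r *v x) \<in> S" "down (ext_mat q Y s *v x) \<in> S"
        if "down x \<in> S" for x
        unfolding down_ext using S that by (simp_all add: vec.subspace_add vec.subspace_scale)
      ultimately have "{x. down x \<in> S} = UNIV" using cyc unfolding cyclic_def by simp
      then have "down (up u) \<in> S" for u by blast
      then show "S = UNIV" unfolding down_up by blast
    qed
    then show "(X, Y) \<in> Vs p q" unfolding Vs_def by auto
  next
    assume V: "(X, Y) \<in> Vs p q"
    show "cyclic (ext_mat p X r) (ext_mat q Y s) e0"
      unfolding cyclic_def
    proof (intro allI impI)
      fix S assume S: "vec.subspace S" "e0 \<in> S" "\<forall>u\<in>S. ext_mat p X r *v u \<in> S"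
        "\<forall>u\<in>S. ext_mat q Y s *v u \<in> S"
      define T where "T = {u. up u \<in> S}"
      have "vec.subspace T"
        using S(1) by (simp add: vec.subspace_def up_lin T_def)
      moreover have "axis p 1 \<in> T" "axis q 1 \<in> T"
        using S ext_mat_e0[of p X r] ext_mat_e0[of q Y s] by (auto simp: T_def up_axis)
      moreover have "\<forall>u\<in>T. X *v u \<in> T" "\<forall>u\<in>T. Y *v u \<in> T"
        unfolding T_def mem_Collect_eq up_ext[of X _ p r] up_ext[of Y _ q s] Ball_def
        using S by (simp_all add: vec.subspace_diff vec.subspace_scale)
      ultimately have "T = UNIV" using V unfolding Vs_def by blast
      then have "up u \<in> S" for u unfolding T_def by blast
      then have "x \<in> S" for x
        using split[of x] S vec.subspace_add vec.subspace_scale by metis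
      then show "S = UNIV" by blast
    qed
  qed
qed

definition commuting_pairs ::
  "'k::finite \<Rightarrow> 'k \<Rightarrow> ((complex^('k option)^('k option)) \<times> (complex^('k option)^('k option))) set"
  where "commuting_pairs p q = {(A, B). A ** B = B ** A \<and> A *v e0 = axis (Some p) 1 \<and>
    B *v e0 = axis (Some q) 1 \<and> cyclic A B e0}"

text \<open>
  The rows to be added are forced: the lower right block of \<open>AB = BA\<close> reads
  \<open>[X, Y] = e\<^sub>q r - e\<^sub>p s\<close> for the first rows \<open>r\<close> of
  \<open>A\<close> and \<open>s\<close> of \<open>B\<close>.
\<close>

definition extend :: "'k::finite \<Rightarrow> 'k \<Rightarrow> 'k matpair \<Rightarrow>
    (complex^('k option)^('k option)) \<times> (complex^('k option)^('k option))"
  where "extend p q = (\<lambda>(X, Y). (ext_mat p X ((X ** Y - Y ** X) $ q),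
      ext_mat q Y (- (X ** Y - Y ** X) $ p)))"

definition blocks :: "(complex^('k option)^('k option)) \<times> (complex^('k option)^('k option)) \<Rightarrow>
    'k::finite matpair"
  where "blocks = (\<lambda>(A, B). (mat_part A, mat_part B))"

lemma level_set_iff:
  "(X, Y) \<in> level_set p q \<longleftrightarrow> (X, Y) \<in> Vs p q \<and> (\<forall>i. X $ i $ q = Y $ i $ p) \<and>
    (\<forall>i. i \<noteq> p \<longrightarrow> i \<noteq> q \<longrightarrow> (X ** Y - Y ** X) $ i = 0)"
  unfolding level_set_def V0s_def hat_mu_def mu_def alpha_def
  by (auto simp: vec_eq_iff zero_prod_def)

lemma blocks_ext [simp]: "blocks (extend p q z) = z"
  by (simp add: blocks_def extend_def split: prod.split)

lemma commuting_blocks: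
  assumes "p \<noteq> q" "(A, B) \<in> commuting_pairs p q"
  shows "blocks (A, B) \<in> level_set p q" "extend p q (blocks (A, B)) = (A, B)"
proof -
  define X Y r s where XY: "X = mat_part A" "Y = mat_part B" "r = row_part A" "s = row_part B"
  have AB: "A = ext_mat p X r" "B = ext_mat q Y s"
    using assms(2) unfolding commuting_pairs_def XY by (simp_all add: ext_mat_parts)
  have comm: "ext_mat p X r ** ext_mat q Y s = ext_mat q Y s ** ext_mat p X r"
    and cyc: "cyclic (ext_mat p X r) (ext_mat q Y s) e0"
    using assms unfolding commuting_pairs_def AB by auto
  have col: "X $ i $ q = Y $ i $ p" for i
    using comm unfolding mat_eq_option ext_mat_times_nth by blast
  have "axis p 1 $ i * s $ j + (X ** Y) $ i $ j = axis q 1 $ i * r $ j + (Y ** X) $ i $ j" for i j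
    using comm unfolding mat_eq_option ext_mat_times_nth by blast
  then have C: "(X ** Y - Y ** X) $ i $ j = axis q 1 $ i * r $ j - axis p 1 $ i * s $ j" for i j
    by (simp add: algebra_simps)
  have row: "(X ** Y - Y ** X) $ q = r" "(X ** Y - Y ** X) $ p = - s"
    "\<And>i. i \<noteq> p \<Longrightarrow> i \<noteq> q \<Longrightarrow> (X ** Y - Y ** X) $ i = 0"
    unfolding vec_eq_iff C using assms(1) by (auto simp: axis_def)
  show "blocks (A, B) \<in> level_set p q"
    using cyc col row(3) by (simp add: blocks_def level_set_iff cyclic_ext_mat_iff flip: XY)
  show "extend p q (blocks (A, B)) = (A, B)"
  proof -
    have "- (X ** Y - Y ** X) $ p = s" unfolding row(2) by simp
    then show ?thesis unfolding blocks_def extend_def prod.case XY(1,2)[symmetric] row(1) by (simp only: AB)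
  qed
qed

text \<open>
  The equations of the level set say that the lower right block and the first column of \<open>[A,
  B]\<close> vanish; for the corner entry this uses that \<open>[X, Y]\<close> has trace zero. The
  rest of the first row is then killed by stability.
\<close>

lemma ext_level_set:
  assumes "p \<noteq> q" "z \<in> level_set p q"
  shows "extend p q z \<in> commuting_pairs p q"
proof -
  obtain X Y where z: "z = (X, Y)" by (cases z)
  define C r s where C: "C = X ** Y - Y ** X" and r: "r = C $ q" and s: "s = - C $ p"
  define A B where A: "A = ext_mat p X r" and B: "B = ext_mat q Y s"
  have lev: "(X, Y) \<in> Vs p q" "\<And>i. X $ i $ q = Y $ i $ p"
    "\<And>i. i \<noteq> p \<Longrightarrow> i \<noteq> q \<Longrightarrow> C $ i = 0"
    using assms(2) unfolding z level_set_iff C by auto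
  have cyc: "cyclic A B e0" unfolding A B cyclic_ext_mat_iff using lev(1) .
  have "trace C = 0" unfolding C by (simp add: trace_sub trace_mul_sym[of X Y])
  moreover have "trace C = (\<Sum>i\<in>{p, q}. C $ i $ i)"
    unfolding trace_def using lev(3) by (intro sum.mono_neutral_right) auto
  ultimately have rs: "r $ q = s $ p" using assms(1) by (simp add: r s eq_neg_iff_add_eq_0 add.commute)
  have rows: "axis p 1 $ i * s $ j + (X ** Y) $ i $ j = axis q 1 $ i * r $ j + (Y ** X) $ i $ j" for i j
  proof -
    have "(X ** Y) $ i $ j = C $ i $ j + (Y ** X) $ i $ j" by (simp add: C)
    then show ?thesis using lev(3)[of i] assms(1) by (auto simp: axis_def r s)
  qed
  \<comment> \<open>only the first row of the commutator can be non-zero, and stability kills it\<close>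
  define w where "w = row None (A ** B - B ** A)"
  have "A ** B - B ** A = outer e0 w"
    unfolding mat_eq_option using rs lev(2) rows
    by (simp add: A B ext_mat_times_nth outer_def w_def row_def)
  then have "w = 0" using rank_one_commutator_eq_0 cyc by blast
  then have "A ** B = B ** A"
    using \<open>A ** B - B ** A = outer e0 w\<close> by (simp add: outer_def vec_eq_iff)
  then show ?thesis
    using cyc by (simp add: commuting_pairs_def extend_def z A B r s C ext_mat_e0)
qed

section \<open>The group and its action by conjugation\<close>

text \<open>
  The group \<open>hatG0\<close> described by what it fixes, which makes closure under products
  and inverses evident.
\<close>

definition fixing_group :: "'k::finite \<Rightarrow> 'k \<Rightarrow> (complex^('k option)^('k option)) set"
  where "fixing_group p q = {g. invertible g \<and> g *v e0 = e0 \<and>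
    g *v axis (Some p) 1 = axis (Some p) 1 \<and> g *v axis (Some q) 1 = axis (Some q) 1}"

lemma block_mat_nth [simp]:
  "block_mat u h $ None $ None = 1" "block_mat u h $ None $ Some j = u $ j"
  "block_mat u h $ Some i $ None = 0" "block_mat u h $ Some i $ Some j = h $ i $ j"
  by (simp_all add: block_mat_def)

lemma block_mat_parts [simp]: "mat_part (block_mat u h) = h" "row_part (block_mat u h) = u"
  by (simp_all add: vec_eq_iff)

lemma block_mat_times:
  "block_mat u h ** block_mat u' h' = block_mat (u' + u v* h') (h ** h')"
  unfolding mat_eq_option
  by (simp add: matrix_matrix_mult_def sum_option vector_matrix_mult_def mult.commute)

lemma block_mat_1: "block_mat 0 (mat 1) = mat 1"
  unfolding mat_eq_option by (simp add: mat_def)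

lemma block_mat_inverse:
  assumes "invertible h"
  shows "block_mat u h ** block_mat (- (u v* matrix_inv h)) (matrix_inv h) = mat 1"
  by (simp add: block_mat_times matrix_inv_right[OF assms] block_mat_1)

lemma invertible_block_mat: "invertible (block_mat u h) \<longleftrightarrow> invertible h"
proof
  assume "invertible (block_mat u h)"
  then obtain g where g: "block_mat u h ** g = mat 1" "g ** block_mat u h = mat 1"
    unfolding invertible_def by blast
  have "(h ** mat_part g) $ i $ j = (mat 1 :: complex^'a^'a) $ i $ j" for i j
  proof -
    have "(block_mat u h ** g) $ Some i $ Some j = (h ** mat_part g) $ i $ j"
      by (simp add: matrix_matrix_mult_def sum_option)
    then show ?thesis by (simp add: g mat_def)
  qed
  then have "h ** mat_part g = mat 1" by (simp add: vec_eq_iff)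
  then show "invertible h" using invertible_right_inverse by blast
next
  assume "invertible h"
  then show "invertible (block_mat u h)" using block_mat_inverse invertible_right_inverse by blast
qed

lemma block_mat_of_parts: "g *v e0 = e0 \<Longrightarrow> block_mat (row_part g) (mat_part g) = g"
  unfolding mult_axis mat_eq_option by (simp add: column_def vec_eq_iff)

lemma block_mat_fixes:
  "block_mat u h *v e0 = e0"
  "block_mat u h *v axis (Some i) 1 = axis (Some i) 1 \<longleftrightarrow> u $ i = 0 \<and> column i h = axis i 1"
proof -
  have all: "(\<forall>x :: 'a option. P x) \<longleftrightarrow> P None \<and> (\<forall>x. P (Some x))" for P
    by (metis option.exhaust)
  show "block_mat u h *v e0 = e0"
    "block_mat u h *v axis (Some i) 1 = axis (Some i) 1 \<longleftrightarrow> u $ i = 0 \<and> column i h = axis i 1"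
    unfolding mult_axis vec_eq_iff all by (simp_all add: column_def)
qed

lemma carrier_hatG0: "carrier (hatG0 p q) = fixing_group p q"
proof -
  have "g \<in> fixing_group p q \<longleftrightarrow>
    (\<exists>u h. g = block_mat u h \<and> h \<in> G0 p q \<and> u $ p = 0 \<and> u $ q = 0)" (is "_ \<longleftrightarrow> ?R") for g
  proof
    assume g: "g \<in> fixing_group p q"
    then have "g = block_mat (row_part g) (mat_part g)"
      using block_mat_of_parts unfolding fixing_group_def by (metis (mono_tags) mem_Collect_eq)
    moreover have "block_mat (row_part g) (mat_part g) \<in> fixing_group p q" using g calculation by simp
    ultimately show ?R unfolding fixing_group_def mem_Collect_eq block_mat_fixes invertible_block_mat G0_def
      by blast
  next
    assume ?R
    then show "g \<in> fixing_group p q"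
      unfolding fixing_group_def mem_Collect_eq G0_def
      by (auto simp: block_mat_fixes invertible_block_mat)
  qed
  then show ?thesis unfolding hatG0_def by auto
qed

lemma fixing_group_mult:
  "g \<in> fixing_group p q \<Longrightarrow> h \<in> fixing_group p q \<Longrightarrow> g ** h \<in> fixing_group p q"
  by (simp add: fixing_group_def invertible_mult flip: matrix_vector_mul_assoc)

lemma fixing_group_1: "mat 1 \<in> fixing_group p q"
  by (auto simp: fixing_group_def invertible_def)

lemma fixing_group_inv:
  assumes "g \<in> fixing_group p q"
  shows "matrix_inv g \<in> fixing_group p q"
proof -
  have "matrix_inv g *v u = u" if "g *v u = u" for u
    using matrix_inv_cancel_left[of g u] assms that unfolding fixing_group_def by simp
  then show ?thesis using assms by (simp add: fixing_group_def matrix_inv_invertible)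
qed

lemma group_hatG0: "group (hatG0 p q)"
proof (rule groupI)
  have sel: "mult (hatG0 p q) = (**)" "one (hatG0 p q) = mat 1" by (simp_all add: hatG0_def)
  show "x \<otimes>\<^bsub>hatG0 p q\<^esub> y \<in> carrier (hatG0 p q)"
    if "x \<in> carrier (hatG0 p q)" "y \<in> carrier (hatG0 p q)" for x y
    using that by (simp add: carrier_hatG0 sel fixing_group_mult)
  show "\<one>\<^bsub>hatG0 p q\<^esub> \<in> carrier (hatG0 p q)" by (simp add: carrier_hatG0 sel fixing_group_1)
  show "x \<otimes>\<^bsub>hatG0 p q\<^esub> y \<otimes>\<^bsub>hatG0 p q\<^esub> z = x \<otimes>\<^bsub>hatG0 p q\<^esub> (y \<otimes>\<^bsub>hatG0 p q\<^esub> z)" for x y z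
    by (simp add: sel matrix_mul_assoc)
  show "\<one>\<^bsub>hatG0 p q\<^esub> \<otimes>\<^bsub>hatG0 p q\<^esub> x = x" for x by (simp add: sel)
  show "\<exists>y\<in>carrier (hatG0 p q). y \<otimes>\<^bsub>hatG0 p q\<^esub> x = \<one>\<^bsub>hatG0 p q\<^esub>"
    if "x \<in> carrier (hatG0 p q)" for x
    using that fixing_group_inv matrix_inv_left unfolding carrier_hatG0 sel fixing_group_def by blast
qed

definition conj_pair :: "complex^'n^'n \<Rightarrow> (complex^'n^'n) \<times> (complex^'n^'n) \<Rightarrow>
    (complex^'n^'n) \<times> (complex^'n^'n)"
  where "conj_pair g = (\<lambda>(A, B). (conj_mat g A, conj_mat g B))"

lemma conj_pair_commuting:
  assumes "g \<in> fixing_group p q" "w \<in> commuting_pairs p q"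
  shows "conj_pair g w \<in> commuting_pairs p q"
proof -
  obtain A B where w: "w = (A, B)" by (cases w)
  have g: "invertible g" "g *v e0 = e0" "matrix_inv g *v e0 = e0"
    "g *v axis (Some p) 1 = axis (Some p) 1" "g *v axis (Some q) 1 = axis (Some q) 1"
    using assms(1) fixing_group_inv[OF assms(1)] unfolding fixing_group_def by auto
  have c: "A ** B = B ** A" "A *v e0 = axis (Some p) 1" "B *v e0 = axis (Some q) 1" "cyclic A B e0"
    using assms(2) unfolding w commuting_pairs_def by auto
  have "cyclic (conj_mat g A) (conj_mat g B) e0"
    using cyclic_conj[OF g(1) c(1,4)] g(2) by simp
  then show ?thesis
    unfolding w conj_pair_def commuting_pairs_def
    by (simp add: conj_mat_times g c) (simp add: conj_mat_def g c flip: matrix_vector_mul_assoc)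
qed

lemma mat_part_times:
  "mat_part (M ** N) = mat_part M ** mat_part N + outer (\<chi> l. M $ Some l $ None) (row_part N)"
  by (simp add: vec_eq_iff matrix_matrix_mult_def sum_option outer_def)

text \<open>
  The rank one term subtracted in the action comes from the product of the first column of
  \<open>g A\<close>, which is \<open>e\<^sub>p\<close> or \<open>e\<^sub>q\<close>, with the
  first row of \<open>g\<^sup>-\<^sup>1\<close>.
\<close>

lemma mat_part_conj:
  assumes g: "g \<in> fixing_group p q" and i: "i = p \<or> i = q" and A: "A *v e0 = axis (Some i) 1"
  defines "h \<equiv> mat_part g" and "h' \<equiv> matrix_inv (mat_part g)"
  shows "mat_part (conj_mat g A) = h ** mat_part A ** h' - outer (axis i 1) (row_part g v* h')"
proof -
  have g': "invertible g" "g *v e0 = e0" "g *v axis (Some i) 1 = axis (Some i) 1"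
    using g i unfolding fixing_group_def by auto
  have h: "block_mat (row_part g) h = g" unfolding h_def by (rule block_mat_of_parts[OF g'(2)])
  then have "invertible h" using g'(1) invertible_block_mat by metis
  then have inv: "matrix_inv g = block_mat (- (row_part g v* h')) h'"
    using block_mat_inverse[of h "row_part g"] h matrix_inv_unique unfolding h'_def h_def by metis
  have 1: "mat_part (g ** A) = h ** mat_part A"
    unfolding mat_part_times h_def using g'(2) unfolding mult_axis
    by (simp add: outer_def column_def vec_eq_iff matrix_matrix_mult_def)
  have "(g ** A) *v e0 = axis (Some i) 1"
    using A g'(3) by (simp flip: matrix_vector_mul_assoc)
  then have 2: "(\<chi> l. (g ** A) $ Some l $ None) = axis i 1"
    unfolding mult_axis by (simp add: column_def vec_eq_iff)
  show ?thesis
    unfolding conj_mat_def inv mat_part_times[of "g ** A"] 1 2 block_mat_parts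
    by (simp add: outer_def vec_eq_iff)
qed

lemma hat_act_eq_conj:
  assumes "p \<noteq> q" "g \<in> fixing_group p q" "z \<in> level_set p q"
  shows "hat_act p q g z = blocks (conj_pair g (extend p q z))"
proof -
  obtain A B where AB: "extend p q z = (A, B)" by (cases "extend p q z")
  have z: "z = (mat_part A, mat_part B)" using blocks_ext[of p q z] by (simp add: AB blocks_def)
  have "A *v e0 = axis (Some p) 1" "B *v e0 = axis (Some q) 1"
    using ext_level_set[OF assms(1,3)] unfolding AB commuting_pairs_def by auto
  then show ?thesis
    unfolding AB unfolding z hat_act_def blocks_def conj_pair_def Let_def prod.case
    using mat_part_conj[OF assms(2), of p A] mat_part_conj[OF assms(2), of q B] by simp
qed

lemma ext_hat_act:
  assumes "p \<noteq> q" "g \<in> fixing_group p q" "z \<in> level_set p q"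
  shows "extend p q (hat_act p q g z) = conj_pair g (extend p q z)"
    and "hat_act p q g z \<in> level_set p q"
proof -
  obtain A B where c: "conj_pair g (extend p q z) = (A, B)" by (cases "conj_pair g (extend p q z)")
  then have "(A, B) \<in> commuting_pairs p q"
    using conj_pair_commuting[OF assms(2) ext_level_set[OF assms(1,3)]] by simp
  from commuting_blocks[OF assms(1) this]
  show "extend p q (hat_act p q g z) = conj_pair g (extend p q z)" "hat_act p q g z \<in> level_set p q"
    by (simp_all add: hat_act_eq_conj[OF assms] c)
qed

lemma ext_inject: "extend p q z = extend p q z' \<Longrightarrow> z = z'"
  by (metis blocks_ext)

lemma hat_act_mult:
  assumes "p \<noteq> q" "g \<in> fixing_group p q" "h \<in> fixing_group p q" "z \<in> level_set p q"
  shows "hat_act p q (g ** h) z = hat_act p q g (hat_act p q h z)"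
proof (rule ext_inject)
  have "invertible g" "invertible h" using assms unfolding fixing_group_def by auto
  then show "extend p q (hat_act p q (g ** h) z) = extend p q (hat_act p q g (hat_act p q h z))"
    using assms
    by (simp add: ext_hat_act fixing_group_mult conj_pair_def conj_mat_mult split: prod.split)
qed

lemma hat_act_1:
  assumes "p \<noteq> q" "z \<in> level_set p q"
  shows "hat_act p q (mat 1) z = z"
  by (rule ext_inject[of p q])
     (simp add: ext_hat_act assms fixing_group_1 conj_pair_def conj_mat_1 split: prod.split)

lemma hat_act_free:
  assumes "p \<noteq> q" "g \<in> fixing_group p q" "h \<in> fixing_group p q" "z \<in> level_set p q"
    and eq: "hat_act p q g z = hat_act p q h z"
  shows "g = h"
proof -
  obtain A B where AB: "extend p q z = (A, B)" by (cases "extend p q z")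
  have c: "A ** B = B ** A" "cyclic A B e0"
    using ext_level_set[OF assms(1,4)] unfolding AB commuting_pairs_def by auto
  have gh: "invertible g" "invertible h" "g *v e0 = h *v e0"
    using assms(2,3) unfolding fixing_group_def by auto
  have same: "conj_mat g A = conj_mat h A" "conj_mat g B = conj_mat h B"
    using ext_hat_act(1)[OF assms(1,2,4)] ext_hat_act(1)[OF assms(1,3,4)] eq
    unfolding AB conj_pair_def by auto
  show ?thesis
  proof (rule intertwiner_unique[OF c(2,1)])
    show "g ** A = conj_mat g A ** g" "g ** B = conj_mat g B ** g"
      by (rule conj_mat_intertwine[OF gh(1)])+
    show "h ** A = conj_mat g A ** h" "h ** B = conj_mat g B ** h"
      unfolding same by (rule conj_mat_intertwine[OF gh(2)])+
  qed (rule gh(3))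
qed

lemma group_action_level:
  assumes "p \<noteq> q"
  shows "group_action (hatG0 p q) (level_set p q) (level_act p q)"
proof -
  have sel: "mult (hatG0 p q) = (**)" by (simp add: hatG0_def)
  have cancel: "hat_act p q (matrix_inv g) (hat_act p q g z) = z"
    "hat_act p q g (hat_act p q (matrix_inv g) z) = z"
    if "g \<in> fixing_group p q" "z \<in> level_set p q" for g z
  proof -
    have "invertible g" using that(1) unfolding fixing_group_def by simp
    then show "hat_act p q (matrix_inv g) (hat_act p q g z) = z"
      "hat_act p q g (hat_act p q (matrix_inv g) z) = z"
      using that assms by (simp_all add: fixing_group_inv matrix_inv_left matrix_inv_right hat_act_1
          flip: hat_act_mult)
  qed
  have bij: "level_act p q g \<in> Bij (level_set p q)" if g: "g \<in> fixing_group p q" for g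
  proof -
    have "bij_betw (hat_act p q g) (level_set p q) (level_set p q)"
    proof (rule bij_betw_byWitness[where f' = "hat_act p q (matrix_inv g)"])
      show "hat_act p q g ` level_set p q \<subseteq> level_set p q"
        using ext_hat_act(2)[OF assms g] by blast
      show "hat_act p q (matrix_inv g) ` level_set p q \<subseteq> level_set p q"
        using ext_hat_act(2)[OF assms fixing_group_inv[OF g]] by blast
    qed (use cancel g in blast)+
    then have "bij_betw (level_act p q g) (level_set p q) (level_set p q)"
      unfolding level_act_def by (simp cong: bij_betw_cong)
    then show ?thesis unfolding Bij_def level_act_def by auto
  qed
  have "level_act p q \<in> hom (hatG0 p q) (BijGroup (level_set p q))"
  proof (rule homI)
    fix g h assume gh: "g \<in> carrier (hatG0 p q)" "h \<in> carrier (hatG0 p q)"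
    have "level_act p q (g ** h) = compose (level_set p q) (level_act p q g) (level_act p q h)"
      using gh assms unfolding carrier_hatG0
      by (auto simp: compose_def level_act_def hat_act_mult ext_hat_act intro!: restrict_ext)
    then show "level_act p q (g \<otimes>\<^bsub>hatG0 p q\<^esub> h) =
        level_act p q g \<otimes>\<^bsub>BijGroup (level_set p q)\<^esub> level_act p q h"
      using gh bij by (simp add: BijGroup_def sel carrier_hatG0)
  qed (simp add: BijGroup_def bij carrier_hatG0)
  then have "group_hom (hatG0 p q) (BijGroup (level_set p q)) (level_act p q)"
    by (simp add: group_hom_def group_hom_axioms_def group_hatG0 group_BijGroup)
  then show ?thesis by (simp add: group_action_def)
qed

lemma free_action_level:
  assumes "p \<noteq> q"
  shows "free_action (hatG0 p q) (level_set p q) (level_act p q)"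
proof -
  have one: "one (hatG0 p q) = mat 1" by (simp add: hatG0_def)
  have "g = mat 1" if "g \<in> fixing_group p q" "z \<in> level_set p q" "hat_act p q g z = z" for g z
    using that assms by (intro hat_act_free[of p q g "mat 1" z]) (simp_all add: fixing_group_1 hat_act_1)
  then show ?thesis
    unfolding free_action_def stabilizer_def carrier_hatG0 one
    using assms by (auto simp: level_act_def fixing_group_1 hat_act_1)
qed

section \<open>Holomorphic maps between complex vector spaces\<close>

text \<open>
  Differentiability over the complex numbers at a point, for vector-valued maps. It passes to the
  rational expressions in matrix entries that occur below, and it implies continuity, so that the
  topological statements need no separate arguments.
\<close>

definition holo_at ::
  "('a :: {real_normed_vector, complex_vector_space} \<Rightarrow> 'b :: {real_normed_vector, complex_vector_space}) \<Rightarrow>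
    'a \<Rightarrow> bool"
  where "holo_at F z \<longleftrightarrow>
    (\<exists>D. (F has_derivative D) (at z) \<and> (\<forall>c v. D (scaleC c v) = scaleC c (D v)))"

lemma holo_on_iff: "holo_on F U \<longleftrightarrow> open U \<and> (\<forall>z\<in>U. holo_at F z)"
  by (simp add: holo_on_def holo_at_def scaleC_complex_def)

lemma holo_at_isCont: "holo_at F z \<Longrightarrow> isCont F z"
  unfolding holo_at_def using has_derivative_continuous by blast

lemma scaleC_0 [simp]: "scaleC c 0 = 0"
  using scaleC_add_right[of c 0 0] by simp

lemma holo_at_const: "holo_at (\<lambda>z. c) z"
  unfolding holo_at_def by (rule exI[of _ "\<lambda>v. 0"]) simp

lemma holo_at_compose:
  assumes "holo_at F z" "holo_at G (F z)"
  shows "holo_at (\<lambda>z. G (F z)) z"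
proof -
  obtain D E where D: "(F has_derivative D) (at z)" "\<forall>c v. D (scaleC c v) = scaleC c (D v)"
    and E: "(G has_derivative E) (at (F z))" "\<forall>c v. E (scaleC c v) = scaleC c (E v)"
    using assms unfolding holo_at_def by blast
  show ?thesis
    unfolding holo_at_def
    by (rule exI[of _ "\<lambda>v. E (D v)"]) (simp add: has_derivative_compose[OF D(1) E(1)] D(2) E(2))
qed

lemma holo_at_linear:
  assumes "bounded_linear h" "\<And>c v. h (scaleC c v) = scaleC c (h v)" "holo_at F z"
  shows "holo_at (\<lambda>z. h (F z)) z"
proof -
  obtain D where D: "(F has_derivative D) (at z)" "\<And>c v. D (scaleC c v) = scaleC c (D v)"
    using assms(3) unfolding holo_at_def by blast
  show ?thesis
    unfolding holo_at_def
    by (rule exI[of _ "\<lambda>v. h (D v)"])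
       (simp add: bounded_linear.has_derivative[OF assms(1) D(1)] D(2) assms(2))
qed

lemma holo_at_id: "holo_at (\<lambda>z. z) z"
  unfolding holo_at_def by (rule exI[of _ "\<lambda>v. v"]) simp

lemma holo_at_fst: "holo_at F z \<Longrightarrow> holo_at (\<lambda>z. fst (F z)) z"
  and holo_at_snd: "holo_at F z \<Longrightarrow> holo_at (\<lambda>z. snd (F z)) z"
  by (rule holo_at_linear; auto simp: scaleC_prod_def bounded_linear_fst bounded_linear_snd)+

lemma holo_at_nth: "holo_at F z \<Longrightarrow> holo_at (\<lambda>z. F z $ i) z"
  by (rule holo_at_linear[of "\<lambda>v. v $ i"]) (auto simp: scaleC_vec_def bounded_linear_vec_nth)

lemma holo_at_Pair: "holo_at F z \<Longrightarrow> holo_at G z \<Longrightarrow> holo_at (\<lambda>z. (F z, G z)) z"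
proof -
  assume "holo_at F z" "holo_at G z"
  then obtain D E where "(F has_derivative D) (at z)" "\<And>c v. D (scaleC c v) = scaleC c (D v)"
    "(G has_derivative E) (at z)" "\<And>c v. E (scaleC c v) = scaleC c (E v)"
    unfolding holo_at_def by blast
  then show ?thesis
    unfolding holo_at_def
    by (intro exI[of _ "\<lambda>v. (D v, E v)"]) (simp add: has_derivative_Pair scaleC_prod_def)
qed

lemma holo_at_add: "holo_at F z \<Longrightarrow> holo_at G z \<Longrightarrow> holo_at (\<lambda>z. F z + G z) z"
proof -
  assume "holo_at F z" "holo_at G z"
  then obtain D E where "(F has_derivative D) (at z)" "\<And>c v. D (scaleC c v) = scaleC c (D v)"
    "(G has_derivative E) (at z)" "\<And>c v. E (scaleC c v) = scaleC c (E v)"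
    unfolding holo_at_def by blast
  then show ?thesis
    unfolding holo_at_def
    by (intro exI[of _ "\<lambda>v. D v + E v"]) (simp add: has_derivative_add scaleC_add_right)
qed

lemma scaleC_minus: "scaleC c (- v) = - scaleC c v"
  using scaleC_add_right[of c v "- v"] by (simp add: eq_neg_iff_add_eq_0 add.commute)

lemma holo_at_minus: "holo_at F z \<Longrightarrow> holo_at (\<lambda>z. - F z) z"
  by (rule holo_at_linear[of uminus]) (auto simp: scaleC_minus intro: bounded_linear_minus bounded_linear_ident)

lemma holo_at_diff: "holo_at F z \<Longrightarrow> holo_at G z \<Longrightarrow> holo_at (\<lambda>z. F z - G z) z"
  using holo_at_add[of F z "\<lambda>z. - G z"] holo_at_minus[of G z] by simp

lemma holo_at_sum:
  "(\<And>i. i \<in> I \<Longrightarrow> holo_at (F i) z) \<Longrightarrow> holo_at (\<lambda>z. \<Sum>i\<in>I. F i z) z"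
  by (induction I rule: infinite_finite_induct) (auto simp: holo_at_const intro!: holo_at_add)

lemma bounded_linear_axis: "bounded_linear (axis i :: 'a :: real_normed_vector \<Rightarrow> 'a ^ 'n :: finite)"
proof (rule bounded_linear_intro)
  show "norm (axis i x :: 'a ^ 'n) \<le> norm x * 1" for x :: 'a
  proof -
    have "norm (axis i x :: 'a ^ 'n) \<le> (\<Sum>j\<in>UNIV. norm (axis i x $ j :: 'a))"
      unfolding norm_vec_def by (rule L2_set_le_sum) simp
    also have "\<dots> = norm x" by (simp add: axis_def if_distrib cong: if_cong)
    finally show ?thesis by simp
  qed
qed (auto simp: axis_def vec_eq_iff)

lemma holo_at_vec:
  fixes F :: "'i :: finite \<Rightarrow> 'a :: {real_normed_vector, complex_vector_space} \<Rightarrow>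
      'b :: {real_normed_vector, complex_vector_space}"
  assumes "\<And>i. holo_at (F i) z"
  shows "holo_at (\<lambda>z. \<chi> i. F i z) z"
proof -
  have "(\<chi> i. F i z) = (\<Sum>i\<in>UNIV. axis i (F i z))" for z
    by (simp add: vec_eq_iff axis_def if_distrib cong: if_cong)
  moreover have "holo_at (\<lambda>z. axis i (F i z) :: 'b ^ 'i) z" for i
    by (rule holo_at_linear[OF bounded_linear_axis])
       (auto simp: assms axis_def scaleC_vec_def vec_eq_iff)
  ultimately show ?thesis by (simp add: holo_at_sum)
qed

lemma holo_at_mult:
  fixes F G :: "'a :: {real_normed_vector, complex_vector_space} \<Rightarrow> complex"
  assumes "holo_at F z" "holo_at G z"
  shows "holo_at (\<lambda>z. F z * G z) z"
proof -
  obtain D E where D: "(F has_derivative D) (at z)" "\<And>c v. D (scaleC c v) = c * D v"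
    and E: "(G has_derivative E) (at z)" "\<And>c v. E (scaleC c v) = c * E v"
    using assms unfolding holo_at_def scaleC_complex_def by blast
  show ?thesis
    unfolding holo_at_def scaleC_complex_def
    by (rule exI[of _ "\<lambda>v. F z * E v + D v * G z"], rule conjI[OF has_derivative_mult[OF D(1) E(1)]])
       (simp add: algebra_simps D(2) E(2))
qed

lemma holo_at_prod:
  fixes F :: "'i \<Rightarrow> 'a :: {real_normed_vector, complex_vector_space} \<Rightarrow> complex"
  shows "(\<And>i. i \<in> I \<Longrightarrow> holo_at (F i) z) \<Longrightarrow> holo_at (\<lambda>z. \<Prod>i\<in>I. F i z) z"
  by (induction I rule: infinite_finite_induct) (auto simp: holo_at_const intro!: holo_at_mult)

lemma holo_at_divide:
  fixes F G :: "'a :: {real_normed_vector, complex_vector_space} \<Rightarrow> complex"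
  assumes "holo_at F z" "holo_at G z" "G z \<noteq> 0"
  shows "holo_at (\<lambda>z. F z / G z) z"
proof -
  have "holo_at inverse (G z)"
    unfolding holo_at_def scaleC_complex_def
    using has_derivative_inverse'[OF assms(3), of UNIV]
    by (intro exI[of _ "\<lambda>h. - (inverse (G z) * h * inverse (G z))"]) auto
  then have "holo_at (\<lambda>z. F z * inverse (G z)) z"
    by (rule holo_at_mult[OF assms(1) holo_at_compose[OF assms(2)]])
  then show ?thesis by (simp add: divide_inverse)
qed

lemma holo_at_cong:
  assumes "holo_at F z" "open U" "z \<in> U" "\<And>w. w \<in> U \<Longrightarrow> F w = G w"
  shows "holo_at G z"
proof -
  obtain D where D: "(F has_derivative D) (at z)" "\<forall>c v. D (scaleC c v) = scaleC c (D v)"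
    using assms unfolding holo_at_def by blast
  show ?thesis
    unfolding holo_at_def
    using has_derivative_transform_within_open[OF D(1) assms(2-4)] D(2) by blast
qed

lemma holo_at_matrix_mult:
  fixes F :: "'a :: {real_normed_vector, complex_vector_space} \<Rightarrow> complex^'n^'m"
    and G :: "'a \<Rightarrow> complex^'l^'n"
  assumes "holo_at F z" "holo_at G z"
  shows "holo_at (\<lambda>z. F z ** G z) z"
  unfolding matrix_matrix_mult_def
  by (intro holo_at_vec holo_at_sum holo_at_mult holo_at_nth assms)

lemma holo_at_matrix_vector_mult:
  fixes F :: "'a :: {real_normed_vector, complex_vector_space} \<Rightarrow> complex^'n^'m"
  assumes "holo_at F z" "holo_at G z"
  shows "holo_at (\<lambda>z. F z *v G z) z"
  unfolding matrix_vector_mult_def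
  by (intro holo_at_vec holo_at_sum holo_at_mult holo_at_nth assms)

lemma holo_at_det:
  fixes F :: "'a :: {real_normed_vector, complex_vector_space} \<Rightarrow> complex^'n^'n"
  assumes "holo_at F z"
  shows "holo_at (\<lambda>z. det (F z)) z"
  unfolding det_def
  by (intro holo_at_sum holo_at_mult holo_at_prod holo_at_nth holo_at_const assms)

lemma open_invertible:
  fixes F :: "'a :: {real_normed_vector, complex_vector_space} \<Rightarrow> complex^'n^'n"
  assumes "\<And>z. holo_at F z"
  shows "open {z. invertible (F z)}"
proof -
  have "continuous_on UNIV (\<lambda>z. det (F z))"
    using holo_at_isCont[OF holo_at_det[OF assms]] by (simp add: continuous_at_imp_continuous_on)
  then show ?thesis
    unfolding invertible_det_nz by (intro open_Collect_neq) auto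
qed

text \<open>
  By Cramer's rule the entries of the inverse are rational functions.
\<close>

lemma holo_at_matrix_inv:
  fixes F :: "'a :: {real_normed_vector, complex_vector_space} \<Rightarrow> complex^'n^'n"
  assumes "holo_at F z" "invertible (F z)"
  shows "holo_at (\<lambda>z. matrix_inv (F z)) z"
proof (rule holo_at_compose[OF assms(1)])
  define cr :: "complex^'n^'n \<Rightarrow> complex^'n^'n"
    where "cr A = (\<chi> i j. det (\<chi> k l. if l = i then axis j 1 $ k else A $ k $ l) / det A)" for A
  have eq: "cr A = matrix_inv A" if "invertible A" for A
  proof (rule mat_eq_axis)
    fix j
    have "A *v (matrix_inv A *v axis j 1) = axis j 1" by (rule matrix_inv_cancel_right[OF that])
    moreover have "det A \<noteq> 0" using that invertible_det_nz by blast
    ultimately have "matrix_inv A *v axis j 1 =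
        (\<chi> i. det (\<chi> k l. if l = i then axis j 1 $ k else A $ k $ l) / det A)"
      using cramer by blast
    then show "cr A *v axis j 1 = matrix_inv A *v axis j 1"
      unfolding mult_axis[of "cr A"] by (simp add: cr_def column_def vec_eq_iff)
  qed
  have "holo_at (\<lambda>A. if l = i then axis j 1 $ k else A $ k $ l) A" for i j k l and A :: "complex^'n^'n"
    by (cases "l = i") (simp_all add: holo_at_const, intro holo_at_nth holo_at_id)
  moreover have "det (F z) \<noteq> 0" using assms(2) invertible_det_nz by blast
  ultimately have "holo_at cr (F z)"
    unfolding cr_def by (intro holo_at_vec holo_at_divide holo_at_det holo_at_id)
  then show "holo_at matrix_inv (F z)"
    by (rule holo_at_cong[where U = "{A. invertible A}"])
       (auto simp: eq assms(2) open_invertible[OF holo_at_id])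
qed

lemma holo_at_conj_mat:
  fixes g F :: "'a :: {real_normed_vector, complex_vector_space} \<Rightarrow> complex^'n^'n"
  assumes "holo_at g z" "holo_at F z" "invertible (g z)"
  shows "holo_at (\<lambda>z. conj_mat (g z) (F z)) z"
  unfolding conj_mat_def by (intro holo_at_matrix_mult holo_at_matrix_inv assms)

lemma holo_at_smult:
  fixes F :: "'a :: {real_normed_vector, complex_vector_space} \<Rightarrow> complex^'n"
  assumes "holo_at F z"
  shows "holo_at (\<lambda>z. c *s F z) z"
  unfolding vector_scalar_mult_def
  by (intro holo_at_vec holo_at_mult holo_at_nth holo_at_const assms)

lemma holo_at_pact:
  fixes A B :: "'a :: {real_normed_vector, complex_vector_space} \<Rightarrow> complex^'n^'n"
  assumes "holo_at A z" "holo_at B z" "holo_at v z"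
  shows "holo_at (\<lambda>z. pact (A z) (B z) f (v z)) z"
proof -
  have "holo_at (\<lambda>z. pact1 (A z) c (v z)) z" for c
  proof (induction c)
    case (pCons a c)
    then show ?case
      by (simp, intro holo_at_add holo_at_smult holo_at_matrix_vector_mult assms)
  qed (simp add: holo_at_const)
  then show ?thesis
  proof (induction f)
    case (pCons c f)
    then show ?case
      by (simp, intro holo_at_add holo_at_matrix_vector_mult assms)
  qed (simp add: holo_at_const)
qed

lemma holo_at_frame:
  fixes A B :: "'a :: {real_normed_vector, complex_vector_space} \<Rightarrow> complex^'n::finite^'n"
  assumes "holo_at A z" "holo_at B z" "holo_at v z"
  shows "holo_at (\<lambda>z. frame (A z) (B z) (v z) b) z"
  unfolding frame_def by (intro holo_at_vec holo_at_nth holo_at_pact assms)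

lemma holo_at_ext_mat:
  fixes X :: "'a :: {real_normed_vector, complex_vector_space} \<Rightarrow> complex^'k::finite^'k"
  assumes "holo_at X z" "holo_at r z"
  shows "holo_at (\<lambda>z. ext_mat p (X z) (r z)) z"
proof -
  have "holo_at (\<lambda>z. ext_mat p (X z) (r z) $ i $ j) z" for i j
    by (cases i; cases j; simp add: holo_at_const) (intro holo_at_nth assms)+
  then have "holo_at (\<lambda>z. \<chi> i j. ext_mat p (X z) (r z) $ i $ j) z"
    by (intro holo_at_vec)
  then show ?thesis by simp
qed

lemma holo_at_ext: "holo_at (extend p q) z"
proof -
  have "extend p q = (\<lambda>z. (ext_mat p (fst z) ((fst z ** snd z - snd z ** fst z) $ q),
      ext_mat q (snd z) (- (fst z ** snd z - snd z ** fst z) $ p)))"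
    by (auto simp: extend_def)
  then show ?thesis
    by (simp only:) (intro holo_at_Pair holo_at_ext_mat holo_at_nth holo_at_minus holo_at_diff
        holo_at_matrix_mult holo_at_fst holo_at_snd holo_at_id)
qed

lemma holo_at_blocks:
  assumes "holo_at F z"
  shows "holo_at (\<lambda>z. blocks (F z)) z"
  unfolding blocks_def case_prod_beta mat_part_def
  by (intro holo_at_Pair holo_at_vec holo_at_nth holo_at_fst holo_at_snd assms)

lemma holo_at_conj_pair:
  assumes "holo_at g z" "holo_at F z" "invertible (g z)"
  shows "holo_at (\<lambda>z. conj_pair (g z) (F z)) z"
  unfolding conj_pair_def case_prod_beta
  by (intro holo_at_Pair holo_at_conj_mat holo_at_fst holo_at_snd assms)

section \<open>Properness\<close>

text \<open>
  The frame of the extended pair. It is holomorphic in the point of the level set and, by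
  \<open>level_frame_act\<close>, equivariant, so it trivialises the action where it is
  invertible.
\<close>

definition level_frame :: "'k::finite \<Rightarrow> 'k \<Rightarrow> ('k option \<Rightarrow> poly2) \<Rightarrow> 'k matpair \<Rightarrow>
    complex^('k option)^('k option)"
  where "level_frame p q b z = frame (fst (extend p q z)) (snd (extend p q z)) e0 b"

lemma holo_at_level_frame: "holo_at (level_frame p q b) z"
  unfolding level_frame_def
  by (intro holo_at_frame holo_at_fst holo_at_snd holo_at_ext holo_at_const)

lemma level_cyclic:
  assumes "p \<noteq> q" "z \<in> level_set p q"
  shows "fst (extend p q z) ** snd (extend p q z) = snd (extend p q z) ** fst (extend p q z)"
    "cyclic (fst (extend p q z)) (snd (extend p q z)) e0"
    "fst (extend p q z) *v e0 = axis (Some p) 1" "snd (extend p q z) *v e0 = axis (Some q) 1"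
  using ext_level_set[OF assms] unfolding commuting_pairs_def by auto

lemma exists_level_frame:
  assumes "p \<noteq> q" "z \<in> level_set p q"
  obtains b where "invertible (level_frame p q b z)"
  using exists_frame[OF level_cyclic(1,2)[OF assms]] unfolding level_frame_def by blast

lemma level_frame_act:
  assumes "p \<noteq> q" "g \<in> fixing_group p q" "z \<in> level_set p q"
  shows "level_frame p q b (hat_act p q g z) = g ** level_frame p q b z"
proof (rule mat_eq_axis)
  fix j
  obtain A B where AB: "extend p q z = (A, B)" by (cases "extend p q z")
  have g: "invertible g" "g *v e0 = e0" using assms(2) unfolding fixing_group_def by auto
  have "pact (conj_mat g A) (conj_mat g B) (b j) e0 = g *v pact A B (b j) e0"
    using pact_intertwine[OF conj_mat_intertwine[OF g(1)] conj_mat_intertwine[OF g(1)], of A B "b j" e0]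
      g(2) by simp
  then show "level_frame p q b (hat_act p q g z) *v axis j 1 = g ** level_frame p q b z *v axis j 1"
    by (simp add: level_frame_def ext_hat_act(1)[OF assms] AB conj_pair_def frame_axis
        flip: matrix_vector_mul_assoc)
qed

lemma tendsto_holo: "holo_at F a \<Longrightarrow> x \<longlonglongrightarrow> a \<Longrightarrow> (\<lambda>n. F (x n)) \<longlonglongrightarrow> F a"
  using holo_at_isCont isCont_tendsto_compose by blast

lemma tendsto_matrix_mult:
  fixes F G :: "nat \<Rightarrow> complex^'n::finite^'n"
  assumes "F \<longlonglongrightarrow> a" "G \<longlonglongrightarrow> b"
  shows "(\<lambda>n. F n ** G n) \<longlonglongrightarrow> a ** b"
proof -
  have "holo_at (\<lambda>w :: (complex^'n^'n) \<times> (complex^'n^'n). fst w ** snd w) (a, b)"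
    by (intro holo_at_matrix_mult holo_at_fst holo_at_snd holo_at_id)
  from tendsto_holo[OF this tendsto_Pair[OF assms]] show ?thesis by simp
qed

lemma tendsto_matrix_vector:
  fixes F :: "nat \<Rightarrow> complex^'n::finite^'n"
  assumes "F \<longlonglongrightarrow> a"
  shows "(\<lambda>n. F n *v u) \<longlonglongrightarrow> a *v u"
proof -
  have "holo_at (\<lambda>w :: complex^'n^'n. w *v u) a"
    by (intro holo_at_matrix_vector_mult holo_at_id holo_at_const)
  from tendsto_holo[OF this assms] show ?thesis .
qed

text \<open>
  By equivariance \<open>g = P (g z) (P z)\<^sup>-\<^sup>1\<close>, and the right-hand side
  converges when \<open>z\<close> and \<open>g z\<close> do.
\<close>

lemma transporter_convergent:
  assumes pq: "p \<noteq> q" and z: "z \<in> level_set p q" "\<And>n. zs n \<in> level_set p q" "zs \<longlonglongrightarrow> z"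
    and g: "\<And>n. gs n \<in> fixing_group p q" and w: "(\<lambda>n. hat_act p q (gs n) (zs n)) \<longlonglongrightarrow> w"
  obtains a where "gs \<longlonglongrightarrow> a"
proof -
  obtain b where b: "invertible (level_frame p q b z)" using exists_level_frame[OF pq z(1)] .
  let ?P = "level_frame p q b"
  have inv: "holo_at (\<lambda>u. matrix_inv (?P u)) z"
    by (intro holo_at_matrix_inv holo_at_level_frame b)
  have "(\<lambda>n. ?P (hat_act p q (gs n) (zs n)) ** matrix_inv (?P (zs n))) \<longlonglongrightarrow> ?P w ** matrix_inv (?P z)"
    by (intro tendsto_matrix_mult tendsto_holo[OF inv z(3)] tendsto_holo[OF holo_at_level_frame w])
  moreover have "\<forall>\<^sub>F n in sequentially. zs n \<in> {u. invertible (?P u)}"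
    using topological_tendstoD[OF z(3) open_invertible[OF holo_at_level_frame]] b by simp
  then have "\<forall>\<^sub>F n in sequentially. ?P (hat_act p q (gs n) (zs n)) ** matrix_inv (?P (zs n)) = gs n"
    by eventually_elim
       (simp add: level_frame_act[OF pq g z(2)] matrix_inv_right flip: matrix_mul_assoc)
  ultimately have "gs \<longlonglongrightarrow> ?P w ** matrix_inv (?P z)" by (rule Lim_transform_eventually)
  then show ?thesis by (rule that)
qed

text \<open>
  The limit of invertible matrices could be singular. Exchanging the roles of the two sequences
  shows that the inverses converge too, so it is not.
\<close>

lemma transporter_limit:
  assumes pq: "p \<noteq> q" and z: "z \<in> level_set p q" "\<And>n. zs n \<in> level_set p q" "zs \<longlonglongrightarrow> z"
    and g: "\<And>n. gs n \<in> fixing_group p q"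
    and w: "(\<lambda>n. hat_act p q (gs n) (zs n)) \<longlonglongrightarrow> w" "w \<in> level_set p q"
  obtains a where "a \<in> fixing_group p q" "gs \<longlonglongrightarrow> a"
proof -
  obtain a where a: "gs \<longlonglongrightarrow> a" using transporter_convergent[OF pq z g w(1)] by blast
  have ginv: "invertible (gs n)" "gs n *v e0 = e0" "gs n *v axis (Some p) 1 = axis (Some p) 1"
    "gs n *v axis (Some q) 1 = axis (Some q) 1" for n using g unfolding fixing_group_def by auto
  have undo_act: "hat_act p q (matrix_inv (gs n)) (hat_act p q (gs n) (zs n)) = zs n" for n
    by (simp add: pq z(2) g fixing_group_inv matrix_inv_left[OF ginv(1)] hat_act_1 flip: hat_act_mult)
  \<comment> \<open>the inverses carry the second sequence back to the first\<close>
  have "\<exists>a'. (\<lambda>n. matrix_inv (gs n)) \<longlonglongrightarrow> a'"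
    by (rule transporter_convergent[of p q w "\<lambda>n. hat_act p q (gs n) (zs n)" "\<lambda>n. matrix_inv (gs n)" z])
       (auto simp: pq w g z undo_act ext_hat_act fixing_group_inv)
  then obtain a' where a': "(\<lambda>n. matrix_inv (gs n)) \<longlonglongrightarrow> a'" by blast
  have "(\<lambda>n. gs n ** matrix_inv (gs n)) \<longlonglongrightarrow> a ** a'" by (rule tendsto_matrix_mult[OF a a'])
  then have "a ** a' = mat 1" by (simp add: matrix_inv_right[OF ginv(1)] LIMSEQ_const_iff)
  then have "invertible a" using invertible_right_inverse by blast
  moreover have "a *v u = u" if "\<And>n. gs n *v u = u" for u
    using tendsto_matrix_vector[OF a, of u] unfolding that by (simp add: LIMSEQ_const_iff)
  ultimately have "a \<in> fixing_group p q" unfolding fixing_group_def using ginv by simp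
  then show ?thesis using a that by blast
qed

lemma isCont_hat_act:
  assumes "invertible (fst w)"
  shows "isCont (\<lambda>w. blocks (conj_pair (fst w) (extend p q (snd w)))) w"
  by (intro holo_at_isCont holo_at_blocks holo_at_conj_pair holo_at_fst holo_at_snd holo_at_id
      holo_at_compose[where G = "extend p q", OF holo_at_snd[OF holo_at_id] holo_at_ext] assms)

text \<open>
  The map \<open>(g, z) \<mapsto> (g z, z)\<close> is injective as the action is free, so its
  fibres are finite. It is closed because in a sequence of images converging to a point of the
  product, the group elements converge by \<open>transporter_limit\<close>.
\<close>

lemma proper_action_level:
  assumes pq: "p \<noteq> q"
  shows "proper_action (hatG0 p q) (level_set p q) (level_act p q)"
proof -
  let ?G = "fixing_group p q" and ?L = "level_set p q"
  define \<theta> where "\<theta> = (\<lambda>(g, z). (level_act p q g z, z))"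
  have \<theta>_eq: "\<theta> w = (blocks (conj_pair (fst w) (extend p q (snd w))), snd w)" if "w \<in> ?G \<times> ?L" for w
    using that pq by (auto simp: \<theta>_def level_act_def hat_act_eq_conj)
  have \<theta>_hat: "\<theta> (g, z) = (hat_act p q g z, z)" if "z \<in> ?L" for g z
    using that by (simp add: \<theta>_def level_act_def)
  have "continuous_on (?G \<times> ?L) (\<lambda>w. (blocks (conj_pair (fst w) (extend p q (snd w))), snd w))"
    by (intro continuous_on_Pair continuous_at_imp_continuous_on ballI isCont_hat_act continuous_on_snd
        continuous_on_id) (auto simp: fixing_group_def)
  then have cont: "continuous_on (?G \<times> ?L) \<theta>"
    using \<theta>_eq by (subst continuous_on_cong[OF refl, of _ \<theta>]) auto
  have img: "\<theta> \<in> ?G \<times> ?L \<rightarrow> ?L \<times> ?L"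
    using ext_hat_act(2)[OF pq] by (auto simp: \<theta>_hat)
  have inj: "inj_on \<theta> (?G \<times> ?L)"
    using hat_act_free[OF pq] by (auto simp: inj_on_def \<theta>_hat)
  have "closedin (top_of_set (?L \<times> ?L)) (\<theta> ` C)" if C: "closedin (top_of_set (?G \<times> ?L)) C" for C
    unfolding closedin_limpt
  proof (intro conjI allI impI)
    have sub: "C \<subseteq> ?G \<times> ?L" using C closedin_imp_subset by blast
    then show "\<theta> ` C \<subseteq> ?L \<times> ?L" using img by blast
    fix x assume x: "x islimpt \<theta> ` C \<and> x \<in> ?L \<times> ?L"
    then obtain f where f: "\<And>n. f n \<in> \<theta> ` C - {x}" "f \<longlonglongrightarrow> x" unfolding islimpt_sequential by blast
    then have "\<forall>n. \<exists>c. c \<in> C \<and> f n = \<theta> c" by blast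
    then obtain c where c: "\<And>n. c n \<in> C" "\<And>n. f n = \<theta> (c n)" by metis
    define gs zs where gz: "gs n = fst (c n)" "zs n = snd (c n)" for n
    have mem: "gs n \<in> ?G" "zs n \<in> ?L" for n using c(1)[of n] sub unfolding gz by auto
    have fn: "f n = (hat_act p q (gs n) (zs n), zs n)" for n
      using \<theta>_hat[OF mem(2)[of n], of "gs n"] c(2)[of n] by (simp add: gz)
    have lim: "(\<lambda>n. hat_act p q (gs n) (zs n)) \<longlonglongrightarrow> fst x" "zs \<longlonglongrightarrow> snd x"
      using tendsto_fst[OF f(2)] tendsto_snd[OF f(2)] by (simp_all add: fn)
    obtain a where a: "a \<in> ?G" "gs \<longlonglongrightarrow> a"
      using transporter_limit[OF pq _ mem(2) lim(2) mem(1) lim(1)] x by (auto simp: mem_Times_iff)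
    have "c = (\<lambda>n. (gs n, zs n))" by (simp add: gz fun_eq_iff)
    then have climit: "c \<longlonglongrightarrow> (a, snd x)" using tendsto_Pair[OF a(2) lim(2)] by simp
    have ax: "(a, snd x) \<in> ?G \<times> ?L" using a(1) x by (simp add: mem_Times_iff)
    obtain K where K: "closed K" "C = K \<inter> (?G \<times> ?L)" using C unfolding closedin_closed by blast
    then have "(a, snd x) \<in> C" using closed_sequentially[OF K(1) _ climit] c(1) ax by blast
    moreover have "c n \<in> ?G \<times> ?L" for n using c(1) sub by blast
    then have "(\<lambda>n. \<theta> (c n)) \<longlonglongrightarrow> \<theta> (a, snd x)"
      by (intro continuous_on_tendsto_compose[OF cont climit ax] always_eventually allI)
    then have "\<theta> (a, snd x) = x" using f(2) LIMSEQ_unique unfolding c(2) by blast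
    ultimately show "x \<in> \<theta> ` C" by (metis (no_types) imageI)
  qed
  then have closed: "closed_map (top_of_set (?G \<times> ?L)) (top_of_set (?L \<times> ?L)) \<theta>"
    unfolding closed_map_def by blast
  have "compactin (top_of_set (?G \<times> ?L)) {x \<in> ?G \<times> ?L. \<theta> x = y}" for y
  proof (rule finite_imp_compactin)
    have "{x \<in> ?G \<times> ?L. \<theta> x = y} = \<theta> -` {y} \<inter> (?G \<times> ?L)" by blast
    then show "finite {x \<in> ?G \<times> ?L. \<theta> x = y}" using finite_vimage_IntI[OF _ inj, of "{y}"] by simp
  qed auto
  then have "proper_map (top_of_set (?G \<times> ?L)) (top_of_set (?L \<times> ?L)) \<theta>"
    using closed unfolding proper_map_def by simp
  moreover have "continuous_map (top_of_set (?G \<times> ?L)) (top_of_set (?L \<times> ?L)) \<theta>"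
    using cont img by (simp add: continuous_map_subtopology_eu)
  ultimately show ?thesis
    unfolding proper_action_def Let_def carrier_hatG0 prod_topology_subtopology_eu \<theta>_def[symmetric] by blast
qed

section \<open>The quotient and the Hilbert scheme\<close>

text \<open>
  The map from the level set to the Hilbert scheme that induces the biholomorphism.
\<close>

definition level_ideal :: "'k::finite \<Rightarrow> 'k \<Rightarrow> 'k matpair \<Rightarrow> poly2 set"
  where "level_ideal p q z = annih (fst (extend p q z)) (snd (extend p q z)) e0"

lemma level_ideal_domain:
  assumes "p \<noteq> q" "z \<in> level_set p q"
  shows "level_ideal p q z \<in> hilb_domain b \<longleftrightarrow> invertible (level_frame p q b z)"
  using basis_mod_annih_iff[OF level_cyclic(1,2)[OF assms]] poly2_ideal_annih[OF level_cyclic(1)[OF assms]]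
  by (simp add: hilb_domain_def level_ideal_def level_frame_def)

lemma hilb_domain_subset: "hilb_domain (b :: 'n::finite \<Rightarrow> poly2) \<subseteq> hilb_points TYPE('n)"
  by (auto simp: hilb_domain_def hilb_points_def)

lemma contained_in_line_iff:
  assumes "poly2_ideal I"
  shows "contained_in_line I \<longleftrightarrow> (\<exists>a b c. (a, b) \<noteq> (0, 0) \<and> line_poly a b c \<in> I)"
proof -
  have "{g * l | g. True} \<subseteq> I \<longleftrightarrow> l \<in> I" for l
  proof
    assume "{g * l | g. True} \<subseteq> I"
    moreover have "1 * l \<in> {g * l | g. True}" by blast
    ultimately show "l \<in> I" by auto
  next
    assume "l \<in> I"
    then show "{g * l | g. True} \<subseteq> I" using assms unfolding poly2_ideal_def by blast
  qed
  then show ?thesis unfolding contained_in_line_def by simp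
qed

lemma pact_line_poly: "pact A B (line_poly a b c) v = a *s (A *v v) + b *s (B *v v) + c *s v"
  unfolding line_poly_def by (simp add: pact_add pact_const2_mult)

text \<open>
  The classes of \<open>1, x, y\<close> are the basis vectors \<open>e\<^sub>0, e\<^sub>p,
  e\<^sub>q\<close>, so no nonzero linear polynomial lies in the ideal.
\<close>

lemma level_ideal_nonlinear:
  fixes p q :: "'k::finite"
  assumes "p \<noteq> q" "z \<in> level_set p q"
  shows "level_ideal p q z \<in> hilb_nonlinear TYPE('k option)"
proof -
  obtain b where "invertible (level_frame p q b z)" using exists_level_frame[OF assms] .
  then have dom: "level_ideal p q z \<in> hilb_domain b" using level_ideal_domain[OF assms] by simp
  have "a = 0 \<and> d = 0" if "line_poly a d c \<in> level_ideal p q z" for a d c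
  proof -
    have 0: "a *s axis (Some p) 1 + d *s axis (Some q) 1 + c *s e0 = (0 :: complex^('k option))"
      using that by (simp add: level_ideal_def annih_def pact_line_poly level_cyclic[OF assms])
    show ?thesis
      using arg_cong[OF 0, of "\<lambda>v. v $ Some p"] arg_cong[OF 0, of "\<lambda>v. v $ Some q"] assms(1)
      by (simp add: axis_def)
  qed
  moreover have "poly2_ideal (level_ideal p q z)" using dom by (simp add: hilb_domain_def)
  ultimately show ?thesis
    using dom hilb_domain_subset[of b] by (auto simp: hilb_nonlinear_def contained_in_line_iff)
qed

text \<open>
  The conjugating matrix fixes \<open>e\<^sub>0\<close>, hence also its images
  \<open>e\<^sub>p\<close> and \<open>e\<^sub>q\<close> under the two matrices.
\<close>

lemma level_ideal_eq_iff:
  assumes "p \<noteq> q" "z \<in> level_set p q" "z' \<in> level_set p q"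
  shows "level_ideal p q z = level_ideal p q z' \<longleftrightarrow> (\<exists>g\<in>fixing_group p q. z' = hat_act p q g z)"
proof
  assume "\<exists>g\<in>fixing_group p q. z' = hat_act p q g z"
  then obtain g where g: "g \<in> fixing_group p q" "z' = hat_act p q g z" by blast
  then have "invertible g" "g *v e0 = e0" unfolding fixing_group_def by auto
  then show "level_ideal p q z = level_ideal p q z'"
    using annih_conj[of g "fst (extend p q z)" "snd (extend p q z)" e0]
    by (simp add: level_ideal_def g(2) ext_hat_act(1)[OF assms(1) g(1) assms(2)] conj_pair_def case_prod_beta)
next
  assume eq: "level_ideal p q z = level_ideal p q z'"
  note c = level_cyclic[OF assms(1,2)] and c' = level_cyclic[OF assms(1,3)]
  obtain g where g: "invertible g" "fst (extend p q z') = conj_mat g (fst (extend p q z))"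
    "snd (extend p q z') = conj_mat g (snd (extend p q z))" "e0 = g *v e0"
    using annih_eq_imp_conj[OF c(1,2) c'(1,2)] eq unfolding level_ideal_def by blast
  have "g *v (fst (extend p q z) *v e0) = fst (extend p q z') *v (g *v e0)"
    "g *v (snd (extend p q z) *v e0) = snd (extend p q z') *v (g *v e0)"
    unfolding g(2,3) by (simp_all add: matrix_vector_mul_assoc conj_mat_intertwine[OF g(1)])
  then have gfix: "g \<in> fixing_group p q"
    using g(1) c(3,4) c'(3,4) g(4)[symmetric] unfolding fixing_group_def by simp
  moreover have "z' = hat_act p q g z"
    by (rule ext_inject[of p q])
       (simp add: ext_hat_act(1)[OF assms(1) gfix assms(2)] conj_pair_def case_prod_beta prod_eq_iff g(2,3))
  ultimately show "\<exists>g\<in>fixing_group p q. z' = hat_act p q g z" by blast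
qed

lemma orbit_eq_iff:
  assumes "p \<noteq> q" "z \<in> level_set p q" "z' \<in> level_set p q"
  shows "orbit (hatG0 p q) (level_act p q) z = orbit (hatG0 p q) (level_act p q) z' \<longleftrightarrow>
    level_ideal p q z = level_ideal p q z'"
proof -
  have orb: "orbit (hatG0 p q) (level_act p q) z = {hat_act p q g z | g. g \<in> fixing_group p q}"
    if "z \<in> level_set p q" for z
    using that by (simp add: orbit_def carrier_hatG0 level_act_def)
  have orb': "orbit (hatG0 p q) (level_act p q) z =
      {y \<in> level_set p q. level_ideal p q z = level_ideal p q y}" if z: "z \<in> level_set p q" for z
    unfolding orb[OF z] using level_ideal_eq_iff[OF assms(1) z] ext_hat_act(2)[OF assms(1) _ z] by blast
  show ?thesis unfolding orb'[OF assms(2)] orb'[OF assms(3)] using assms(2) by auto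
qed

text \<open>
  The map \<open>level_ideal\<close> read in a chart of the Hilbert scheme.
\<close>

definition chart_map :: "'k::finite \<Rightarrow> 'k \<Rightarrow> ('k option \<Rightarrow> poly2) \<Rightarrow> 'k matpair \<Rightarrow>
    (complex^('k option)^('k option)) \<times> (complex^('k option)^('k option)) \<times> (complex^('k option))"
  where "chart_map p q b z = (let Q = matrix_inv (level_frame p q b z) in
    (conj_mat Q (fst (extend p q z)), conj_mat Q (snd (extend p q z)), Q *v e0))"

lemma hilb_chart_level_ideal:
  assumes "p \<noteq> q" "z \<in> level_set p q" "invertible (level_frame p q b z)"
  shows "hilb_chart b (level_ideal p q z) = chart_map p q b z"
  using hilb_chart_annih[OF level_cyclic(1)[OF assms(1,2)]] assms(3)
  by (simp add: level_ideal_def chart_map_def level_frame_def Let_def)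

lemma holo_at_chart_map:
  assumes "invertible (level_frame p q b z)"
  shows "holo_at (chart_map p q b) z"
proof -
  have "holo_at (\<lambda>z. matrix_inv (level_frame p q b z)) z"
    by (intro holo_at_matrix_inv holo_at_level_frame assms)
  then show ?thesis
    unfolding chart_map_def Let_def
    by (intro holo_at_Pair holo_at_conj_mat holo_at_matrix_vector_mult holo_at_fst holo_at_snd
        holo_at_ext holo_at_const matrix_inv_invertible assms)
qed

text \<open>
  A change of basis after which \<open>v, Av, Bv\<close> become \<open>e\<^sub>0, e\<^sub>p,
  e\<^sub>q\<close>; the other basis vectors are the columns of the constant matrix
  \<open>M\<close>, so the result varies holomorphically with the triple.
\<close>

definition adapted :: "'k::finite \<Rightarrow> 'k \<Rightarrow> complex^('k option)^('k option) \<Rightarrow>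
    (complex^('k option)^('k option)) \<times> (complex^('k option)^('k option)) \<times> (complex^('k option)) \<Rightarrow>
    complex^('k option)^('k option)"
  where "adapted p q M w = (\<chi> i j.
    if j = None then snd (snd w) $ i
    else if j = Some p then (fst w *v snd (snd w)) $ i
    else if j = Some q then (fst (snd w) *v snd (snd w)) $ i
    else M $ i $ j)"

text \<open>
  A local section of \<open>level_ideal\<close> in the coordinates of a chart.
\<close>

definition slice_map :: "'k::finite \<Rightarrow> 'k \<Rightarrow> complex^('k option)^('k option) \<Rightarrow>
    (complex^('k option)^('k option)) \<times> (complex^('k option)^('k option)) \<times> (complex^('k option)) \<Rightarrow>
    'k matpair"
  where "slice_map p q M w =
    blocks (conj_pair (matrix_inv (adapted p q M w)) (fst w, fst (snd w)))"

lemma adapted_axis: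
  assumes "p \<noteq> q"
  shows "adapted p q M (A, B, v) *v e0 = v"
    "adapted p q M (A, B, v) *v axis (Some p) 1 = A *v v"
    "adapted p q M (A, B, v) *v axis (Some q) 1 = B *v v"
  using assms unfolding mult_axis by (simp_all add: adapted_def column_def vec_eq_iff)

lemma holo_at_if: "holo_at F z \<Longrightarrow> holo_at G z \<Longrightarrow> holo_at (\<lambda>z. if c then F z else G z) z"
  by (cases c) simp_all

lemma holo_at_adapted: "holo_at (adapted p q M) w"
  unfolding adapted_def
  by (intro holo_at_vec holo_at_if holo_at_const holo_at_nth holo_at_matrix_vector_mult
      holo_at_fst holo_at_snd holo_at_id)

lemma holo_at_slice_map:
  assumes "invertible (adapted p q M w)"
  shows "holo_at (slice_map p q M) w"
  unfolding slice_map_def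
  by (intro holo_at_blocks holo_at_conj_pair holo_at_matrix_inv holo_at_adapted holo_at_Pair
      holo_at_fst holo_at_snd holo_at_id matrix_inv_invertible assms)

lemma slice_map_level:
  assumes pq: "p \<noteq> q" and I: "I \<in> hilb_domain b"
    and inv: "invertible (adapted p q M (hilb_chart b I))"
  shows "slice_map p q M (hilb_chart b I) \<in> level_set p q"
    "level_ideal p q (slice_map p q M (hilb_chart b I)) = I"
proof -
  obtain A B v where w: "hilb_chart b I = (A, B, v)" by (cases "hilb_chart b I")
  define Q where "Q = adapted p q M (A, B, v)"
  define g where "g = matrix_inv Q"
  have Q: "invertible Q" using inv unfolding w Q_def .
  then have g: "invertible g" "matrix_inv g = Q"
    unfolding g_def by (simp_all add: matrix_inv_invertible matrix_inv_unique matrix_inv_left)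
  have rec: "A ** B = B ** A" "cyclic A B v" "annih A B v = I"
    using hilb_chart_recovers[OF _ _ w] I unfolding hilb_domain_def by auto
  have gv: "g *v v = e0" "g *v (A *v v) = axis (Some p) 1" "g *v (B *v v) = axis (Some q) 1"
    using matrix_inv_cancel_left[OF Q, of e0] matrix_inv_cancel_left[OF Q, of "axis (Some p) 1"]
      matrix_inv_cancel_left[OF Q, of "axis (Some q) 1"]
    by (simp_all add: g_def Q_def adapted_axis[OF pq])
  have "conj_mat g A *v e0 = axis (Some p) 1" "conj_mat g B *v e0 = axis (Some q) 1"
    using gv adapted_axis(1)[OF pq, of M A B v]
    by (simp_all add: conj_mat_def g(2) Q_def flip: matrix_vector_mul_assoc)
  then have comm: "(conj_mat g A, conj_mat g B) \<in> commuting_pairs p q"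
    using cyclic_conj[OF g(1) rec(1,2)] gv(1)
    by (simp add: commuting_pairs_def conj_mat_times[OF g(1)] rec(1))
  have sec: "slice_map p q M (hilb_chart b I) = blocks (conj_mat g A, conj_mat g B)"
    by (simp add: slice_map_def w g_def Q_def conj_pair_def)
  show "slice_map p q M (hilb_chart b I) \<in> level_set p q"
    unfolding sec by (rule commuting_blocks(1)[OF pq comm])
  show "level_ideal p q (slice_map p q M (hilb_chart b I)) = I"
    using annih_conj[OF g(1), of A B v]
    by (simp add: sec level_ideal_def commuting_blocks(2)[OF pq comm] rec(3) gv(1))
qed

lemma complete_to_invertible:
  fixes u :: "'n::finite \<Rightarrow> complex^'n"
  assumes inj: "inj_on u J" and ind: "vec.independent (u ` J)"
  obtains M :: "complex^'n^'n" where
    "invertible (\<chi> i j. if j \<in> J then u j $ i else M $ i $ j)"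
proof -
  obtain B where B: "u ` J \<subseteq> B" "vec.independent B" "UNIV \<subseteq> vec.span B"
    using vec.maximal_independent_subset_extend[OF subset_UNIV ind] by metis
  have fin: "finite B" using vec.finiteI_independent[OF B(2)] .
  have "card B = CARD('n)"
  proof -
    have "vec.span B = vec.span UNIV" using B(3) by (simp add: top.extremum_unique)
    then show ?thesis using vec.dim_eq_card[OF _ B(2), of UNIV] by (simp add: vec.dim_UNIV card_cart_basis)
  qed
  moreover have "card (u ` J) = card J" using inj by (rule card_image)
  ultimately have "card (- J) = card (B - u ` J)"
    using B(1) fin by (simp add: card_Diff_subset finite_subset Compl_eq_Diff_UNIV)
  then obtain t where t: "bij_betw t (- J) (B - u ` J)"
    using finite_same_card_bij[of "- J" "B - u ` J"] fin by auto
  define M :: "complex^'n^'n" where "M = (\<chi> i j. t j $ i)"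
  define Q :: "complex^'n^'n" where "Q = (\<chi> i j. if j \<in> J then u j $ i else M $ i $ j)"
  have "column j Q = (if j \<in> J then u j else t j)" for j
    by (simp add: column_def Q_def M_def vec_eq_iff)
  then have "columns Q = u ` J \<union> t ` (- J)" by (auto simp: columns_def)
  also have "\<dots> = B" using t B(1) by (auto simp: bij_betw_def)
  finally have "invertible Q"
    unfolding invertible_right_inverse matrix_right_invertible_span_columns
    using B(3) by (simp add: top.extremum_unique)
  then show ?thesis using that unfolding Q_def by blast
qed

text \<open>
  If \<open>a Av + d Bv + c v = 0\<close> then \<open>a x + d y + c\<close> lies in the ideal, so
  \<open>v, Av, Bv\<close> are linearly independent and can be completed to a basis.
\<close>

lemma exists_adapted:
  fixes p q :: "'k::finite" and b :: "'k option \<Rightarrow> poly2"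
  assumes pq: "p \<noteq> q" and I: "I \<in> hilb_domain b" and nl: "\<not> contained_in_line I"
  obtains M where "invertible (adapted p q M (hilb_chart b I))"
proof -
  obtain A B v where w: "hilb_chart b I = (A, B, v)" by (cases "hilb_chart b I")
  have rec: "A ** B = B ** A" "cyclic A B v" "annih A B v = I"
    using hilb_chart_recovers[OF _ _ w] I unfolding hilb_domain_def by auto
  have indep: "a = 0 \<and> d = 0" if "a *s (A *v v) + d *s (B *v v) + c *s v = 0" for a d c
  proof -
    have "line_poly a d c \<in> I"
      unfolding rec(3)[symmetric] using that by (simp add: annih_def pact_line_poly)
    moreover have "poly2_ideal I" using I by (simp add: hilb_domain_def)
    ultimately show ?thesis using nl by (auto simp: contained_in_line_iff)
  qed
  have v0: "v \<noteq> 0"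
    using indep[of 1 0 0] by auto
  have A0: "A *v v \<notin> vec.span {v}"
  proof
    assume "A *v v \<in> vec.span {v}"
    then obtain k where "A *v v = k *s v" using vec.span_singleton by blast
    then show False using indep[of 1 0 "- k"] by simp
  qed
  have B0: "B *v v \<notin> vec.span {A *v v, v}"
  proof
    assume "B *v v \<in> vec.span {A *v v, v}"
    then obtain k l where "B *v v - k *s (A *v v) = l *s v"
      unfolding vec.span_insert vec.span_singleton by auto
    then show False using indep[of "- k" 1 "- l"] by (simp add: algebra_simps)
  qed
  define u where "u j = (if j = None then v else if j = Some p then A *v v else B *v v)" for j :: "'k option"
  define J where "J = {None, Some p, Some q}"
  have img: "u ` J = {B *v v, A *v v, v}" using pq by (auto simp: u_def J_def)
  have ne: "A *v v \<noteq> v" "B *v v \<noteq> v" "B *v v \<noteq> A *v v"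
    using A0 B0 by (metis insertCI vec.span_base)+
  have "vec.independent (u ` J)"
    unfolding img using v0 A0 B0 ne by (simp add: vec.independent_insert)
  moreover have "inj_on u J" using ne ne[symmetric] by (auto simp: inj_on_def u_def J_def)
  ultimately obtain M :: "complex^('k option)^('k option)"
    where M: "invertible (\<chi> i j. if j \<in> J then u j $ i else M $ i $ j)"
    using complete_to_invertible by blast
  moreover have "(\<chi> i j. if j \<in> J then u j $ i else M $ i $ j) = adapted p q M (A, B, v)"
    using pq by (auto simp: adapted_def u_def J_def vec_eq_iff)
  ultimately show ?thesis using that w by metis
qed

lemma open_holo_preimage:
  assumes "open V" "\<And>z. z \<in> V \<Longrightarrow> holo_at F z" "open U"
  shows "open {z \<in> V. F z \<in> U}"
proof -
  have "continuous_on V F"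
    by (intro continuous_at_imp_continuous_on ballI holo_at_isCont assms(2))
  then have "open (V \<inter> F -` U)" using assms(1,3) by (rule continuous_open_preimage)
  then show ?thesis by (simp add: vimage_def Int_def)
qed

lemma holo_on_compose:
  assumes "open V" "\<And>z. z \<in> V \<Longrightarrow> holo_at G z" "holo_on F U"
  shows "holo_on (\<lambda>z. F (G z)) {z \<in> V. G z \<in> U}"
proof -
  have "open U" "\<And>z. z \<in> U \<Longrightarrow> holo_at F z" using assms(3) unfolding holo_on_iff by auto
  then show ?thesis
    unfolding holo_on_iff
    by (auto intro!: open_holo_preimage[OF assms(1,2)] holo_at_compose[where G = F, OF assms(2)])
qed

lemma open_adapted: "open {w. invertible (adapted p q M w)}"
  by (rule open_invertible) (rule holo_at_adapted)

lemma open_level_frame: "open {z. invertible (level_frame p q b z)}"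
  by (rule open_invertible) (rule holo_at_level_frame)

lemma slice_map_obtain:
  fixes b :: "'k::finite option \<Rightarrow> poly2"
  assumes "p \<noteq> q" "I \<in> hilb_domain b" "I \<in> hilb_nonlinear TYPE('k option)"
  obtains M where "invertible (adapted p q M (hilb_chart b I))"
  using exists_adapted[OF assms(1,2)] assms(3) unfolding hilb_nonlinear_def by blast

text \<open>
  One direction pulls open sets back along \<open>chart_map\<close>, which is continuous; the
  other pulls them back along the local sections \<open>slice_map\<close>, whose domains cover the
  non-linear part of the chart.
\<close>

lemma openin_level_preimage:
  fixes p q :: "'k::finite"
  assumes pq: "p \<noteq> q" and W: "W \<subseteq> hilb_nonlinear TYPE('k option)"
  shows "openin (top_of_set (level_set p q)) {z \<in> level_set p q. level_ideal p q z \<in> W} \<longleftrightarrow>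
    openin (ctop (hilb TYPE('k option))) W"
proof
  assume op: "openin (ctop (hilb TYPE('k option))) W"
  show "openin (top_of_set (level_set p q)) {z \<in> level_set p q. level_ideal p q z \<in> W}"
  proof (subst openin_subopen, intro ballI)
    fix z assume z: "z \<in> {z \<in> level_set p q. level_ideal p q z \<in> W}"
    then obtain b where b: "invertible (level_frame p q b z)" using exists_level_frame[OF pq] by blast
    have "openin (pullback_topology (hilb_domain b) (hilb_chart b) euclidean) (W \<inter> hilb_domain b)"
      using op unfolding openin_hilb by simp
    then obtain U where U: "open U" "W \<inter> hilb_domain b = hilb_chart b -` U \<inter> hilb_domain b"
      unfolding openin_pullback_topology by auto
    have U2: "I \<in> W \<longleftrightarrow> hilb_chart b I \<in> U" if "I \<in> hilb_domain b" for I
      using U(2) that by blast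
    define T where "T = {z \<in> {z. invertible (level_frame p q b z)}. chart_map p q b z \<in> U}"
    have eq: "z \<in> T \<longleftrightarrow> invertible (level_frame p q b z) \<and> level_ideal p q z \<in> W"
      if "z \<in> level_set p q" for z
    proof (cases "invertible (level_frame p q b z)")
      case True
      then show ?thesis
        using U2[of "level_ideal p q z"] level_ideal_domain[OF pq that, of b]
          hilb_chart_level_ideal[OF pq that True]
        by (simp add: T_def)
    qed (simp add: T_def)
    have "open T" unfolding T_def
      by (rule open_holo_preimage[OF open_level_frame _ U(1)]) (simp add: holo_at_chart_map)
    then have "openin (top_of_set (level_set p q)) (level_set p q \<inter> T)" by (rule openin_open_Int)
    moreover have "z \<in> level_set p q \<inter> T" using z b eq by blast
    moreover have "level_set p q \<inter> T \<subseteq> {z \<in> level_set p q. level_ideal p q z \<in> W}" using eq by blast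
    ultimately show "\<exists>T. openin (top_of_set (level_set p q)) T \<and> z \<in> T \<and>
        T \<subseteq> {z \<in> level_set p q. level_ideal p q z \<in> W}" by blast
  qed
next
  assume "openin (top_of_set (level_set p q)) {z \<in> level_set p q. level_ideal p q z \<in> W}"
  then obtain O' where O': "open O'" "{z \<in> level_set p q. level_ideal p q z \<in> W} = level_set p q \<inter> O'"
    unfolding openin_open by blast
  have O'_iff: "level_ideal p q z \<in> W \<longleftrightarrow> z \<in> O'" if "z \<in> level_set p q" for z
    using O'(2) that by blast
  show "openin (ctop (hilb TYPE('k option))) W"
    unfolding openin_hilb
  proof (intro conjI allI)
    show "W \<subseteq> hilb_points TYPE('k option)" using W unfolding hilb_nonlinear_def by blast
    fix b :: "'k option \<Rightarrow> poly2"
    define U where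
      "U = (\<Union>M. {w \<in> {w. invertible (adapted p q M w)}. slice_map p q M w \<in> O'})"
    have "open U" unfolding U_def
      by (intro open_UN ballI open_holo_preimage[OF open_adapted _ O'(1)]) (simp add: holo_at_slice_map)
    moreover have "I \<in> W \<longleftrightarrow> hilb_chart b I \<in> U" if I: "I \<in> hilb_domain b" for I
    proof
      assume "I \<in> W"
      then obtain M where M: "invertible (adapted p q M (hilb_chart b I))"
        using slice_map_obtain[OF pq I] W by blast
      then have "slice_map p q M (hilb_chart b I) \<in> O'"
        using slice_map_level[OF pq I M] O'_iff \<open>I \<in> W\<close> by metis
      then show "hilb_chart b I \<in> U" unfolding U_def using M by blast
    next
      assume "hilb_chart b I \<in> U"
      then obtain M where M: "invertible (adapted p q M (hilb_chart b I))"
        "slice_map p q M (hilb_chart b I) \<in> O'" unfolding U_def by blast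
      then show "I \<in> W" using slice_map_level[OF pq I M(1)] O'_iff by metis
    qed
    then have "W \<inter> hilb_domain b = hilb_chart b -` U \<inter> hilb_domain b" by blast
    ultimately show "openin (pullback_topology (hilb_domain b) (hilb_chart b) euclidean) (W \<inter> hilb_domain b)"
      unfolding openin_pullback_topology by auto
  qed
qed

lemma level_ideal_surj:
  fixes p q :: "'k::finite"
  assumes pq: "p \<noteq> q"
  shows "level_ideal p q ` level_set p q = hilb_nonlinear TYPE('k option)"
proof
  show "level_ideal p q ` level_set p q \<subseteq> hilb_nonlinear TYPE('k option)"
    using level_ideal_nonlinear[OF pq] by blast
  show "hilb_nonlinear TYPE('k option) \<subseteq> level_ideal p q ` level_set p q"
  proof
    fix I assume I: "I \<in> hilb_nonlinear TYPE('k option)"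
    then obtain b :: "'k option \<Rightarrow> poly2" where b: "I \<in> hilb_domain b"
      unfolding hilb_nonlinear_def hilb_points_def hilb_domain_def by blast
    obtain M where M: "invertible (adapted p q M (hilb_chart b I))" using slice_map_obtain[OF pq b I] .
    show "I \<in> level_ideal p q ` level_set p q" using slice_map_level[OF pq b M] by (metis imageI)
  qed
qed

lemma openin_nonlinear:
  assumes "(p :: 'k::finite) \<noteq> q"
  shows "openin (ctop (hilb TYPE('k option))) (hilb_nonlinear TYPE('k option))"
proof -
  have "{z \<in> level_set p q. level_ideal p q z \<in> hilb_nonlinear TYPE('k option)} = level_set p q"
    using level_ideal_nonlinear[OF assms] by blast
  then show ?thesis using openin_level_preimage[OF assms order_refl] by simp
qed

text \<open>
  Composing a local representation of \<open>f\<close> in a chart with \<open>chart_map\<close>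
  gives one on the level set; composing one on the level set with \<open>slice_map\<close> gives
  one in the chart.
\<close>

lemma hol_level_preimage:
  fixes p q :: "'k::finite"
  assumes pq: "p \<noteq> q" and W: "W \<subseteq> hilb_nonlinear TYPE('k option)"
  shows "f \<in> hol (hilb TYPE('k option)) W \<longleftrightarrow>
    f \<circ> level_ideal p q \<in> induced_hol id {z \<in> level_set p q. level_ideal p q z \<in> W}"
proof
  assume f: "f \<in> hol (hilb TYPE('k option)) W"
  show "f \<circ> level_ideal p q \<in> induced_hol id {z \<in> level_set p q. level_ideal p q z \<in> W}"
    unfolding induced_hol_def
  proof (intro CollectI ballI)
    fix z assume z: "z \<in> {z \<in> level_set p q. level_ideal p q z \<in> W}"
    then obtain b where b: "invertible (level_frame p q b z)" using exists_level_frame[OF pq] by blast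
    have "f \<in> induced_hol (hilb_chart b) (W \<inter> hilb_domain b)" using f by (simp add: hilb_def)
    moreover have "level_ideal p q z \<in> W \<inter> hilb_domain b" using z b level_ideal_domain[OF pq] by blast
    ultimately obtain U F where F: "hilb_chart b (level_ideal p q z) \<in> U" "holo_on F U"
      "\<forall>I\<in>W \<inter> hilb_domain b. hilb_chart b I \<in> U \<longrightarrow> f I = F (hilb_chart b I)"
      unfolding induced_hol_def by blast
    let ?T = "{z \<in> {z. invertible (level_frame p q b z)}. chart_map p q b z \<in> U}"
    have "holo_on (\<lambda>z. F (chart_map p q b z)) ?T"
      by (rule holo_on_compose[OF open_level_frame _ F(2)]) (simp add: holo_at_chart_map)
    moreover have "id z \<in> ?T" using z b F(1) hilb_chart_level_ideal[OF pq _ b] by auto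
    moreover have "(f \<circ> level_ideal p q) y = F (chart_map p q b (id y))"
      if y: "y \<in> {z \<in> level_set p q. level_ideal p q z \<in> W}" "id y \<in> ?T" for y
    proof -
      have yb: "invertible (level_frame p q b y)" "y \<in> level_set p q" using y by auto
      then show ?thesis
        using F(3) hilb_chart_level_ideal[OF pq yb(2,1)] level_ideal_domain[OF pq yb(2), of b] y by auto
    qed
    ultimately show "\<exists>U F. id z \<in> U \<and> holo_on F U \<and> (\<forall>w\<in>{z \<in> level_set p q. level_ideal p q z \<in> W}.
        id w \<in> U \<longrightarrow> (f \<circ> level_ideal p q) w = F (id w))"
      by (intro exI[of _ ?T] exI[of _ "\<lambda>z. F (chart_map p q b z)"] conjI ballI impI)
  qed
next
  assume f: "f \<circ> level_ideal p q \<in> induced_hol id {z \<in> level_set p q. level_ideal p q z \<in> W}"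
  have "f \<in> induced_hol (hilb_chart b) (W \<inter> hilb_domain b)" for b :: "'k option \<Rightarrow> poly2"
    unfolding induced_hol_def
  proof (intro CollectI ballI)
    fix I assume I: "I \<in> W \<inter> hilb_domain b"
    then obtain M where M: "invertible (adapted p q M (hilb_chart b I))"
      using slice_map_obtain[OF pq, of I b] W by blast
    have sec: "slice_map p q M (hilb_chart b I) \<in> {z \<in> level_set p q. level_ideal p q z \<in> W}"
      using slice_map_level[OF pq _ M] I by auto
    then obtain U F where F: "slice_map p q M (hilb_chart b I) \<in> U" "holo_on F U"
      "\<forall>z\<in>{z \<in> level_set p q. level_ideal p q z \<in> W}. z \<in> U \<longrightarrow> f (level_ideal p q z) = F z"
      using f unfolding induced_hol_def comp_def id_def by blast
    let ?T = "{w \<in> {w. invertible (adapted p q M w)}. slice_map p q M w \<in> U}"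
    have "holo_on (\<lambda>w. F (slice_map p q M w)) ?T"
      by (rule holo_on_compose[OF open_adapted _ F(2)]) (simp add: holo_at_slice_map)
    moreover have "hilb_chart b I \<in> ?T" using M F(1) by blast
    moreover have "f K = F (slice_map p q M (hilb_chart b K))"
      if K: "K \<in> W \<inter> hilb_domain b" "hilb_chart b K \<in> ?T" for K
    proof -
      have "invertible (adapted p q M (hilb_chart b K))" "K \<in> hilb_domain b" using K by auto
      note sK = slice_map_level[OF pq this(2,1)]
      then have "slice_map p q M (hilb_chart b K) \<in> {z \<in> level_set p q. level_ideal p q z \<in> W}"
        using K by simp
      from bspec[OF F(3) this] show ?thesis using K(2) sK(2) by simp
    qed
    ultimately show "\<exists>U F. hilb_chart b I \<in> U \<and> holo_on F U \<and>
        (\<forall>w\<in>W \<inter> hilb_domain b. hilb_chart b w \<in> U \<longrightarrow> f w = F (hilb_chart b w))"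
      by (intro exI[of _ ?T] exI[of _ "\<lambda>w. F (slice_map p q M w)"] conjI ballI impI)
  qed
  then show "f \<in> hol (hilb TYPE('k option)) W" by (simp add: hilb_def)
qed

text \<open>
  A surjection with the same fibres as \<open>\<pi>\<close> that induces the topology and the
  holomorphic functions of \<open>Y\<close> identifies \<open>Y\<close> with the quotient by
  \<open>\<pi>\<close>.
\<close>

lemma biholomorphic_quotient_spaceI:
  fixes X :: "'a complex_space" and Y :: "'b complex_space"
  assumes surj: "\<psi> ` topspace (ctop X) = topspace (ctop Y)"
    and fibres: "\<And>x y. x \<in> topspace (ctop X) \<Longrightarrow> y \<in> topspace (ctop X) \<Longrightarrow> \<pi> x = \<pi> y \<longleftrightarrow> \<psi> x = \<psi> y"
    and top: "\<And>W. W \<subseteq> topspace (ctop Y) \<Longrightarrow>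
      openin (ctop X) {x \<in> topspace (ctop X). \<psi> x \<in> W} \<longleftrightarrow> openin (ctop Y) W"
    and hol: "\<And>W f. openin (ctop Y) W \<Longrightarrow>
      f \<in> hol Y W \<longleftrightarrow> f \<circ> \<psi> \<in> hol X {x \<in> topspace (ctop X). \<psi> x \<in> W}"
    and local: "\<And>W f g. W \<subseteq> topspace (ctop X) \<Longrightarrow> (\<And>x. x \<in> W \<Longrightarrow> f x = g x) \<Longrightarrow>
      f \<in> hol X W \<Longrightarrow> g \<in> hol X W"
  shows "biholomorphic (quotient_space X \<pi>) Y"
proof -
  let ?T = "topspace (ctop X)" and ?Q = "quotient_space X \<pi>"
  define \<Phi> where "\<Phi> c = \<psi> (SOME x. x \<in> ?T \<and> \<pi> x = c)" for c
  have \<Phi>: "\<Phi> (\<pi> x) = \<psi> x" if "x \<in> ?T" for x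
  proof -
    have "(SOME y. y \<in> ?T \<and> \<pi> y = \<pi> x) \<in> ?T \<and> \<pi> (SOME y. y \<in> ?T \<and> \<pi> y = \<pi> x) = \<pi> x"
      by (rule someI[of "\<lambda>y. y \<in> ?T \<and> \<pi> y = \<pi> x" x]) (simp add: that)
    then show ?thesis unfolding \<Phi>_def using fibres that by blast
  qed
  have "{x \<in> ?T. \<pi> x \<in> \<pi> ` ?T} = ?T" by blast
  then have "openin (ctop ?Q) (\<pi> ` ?T)" by (simp add: openin_quotient_space)
  then have topQ: "topspace (ctop ?Q) = \<pi> ` ?T"
    using openin_quotient_space[of X \<pi>] by (metis openin_subset openin_topspace subset_antisym)
  have pre: "{x \<in> ?T. \<pi> x \<in> {c \<in> \<pi> ` ?T. \<Phi> c \<in> U}} = {x \<in> ?T. \<psi> x \<in> U}" for U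
  proof -
    have "\<pi> x \<in> {c \<in> \<pi> ` ?T. \<Phi> c \<in> U} \<longleftrightarrow> \<psi> x \<in> U" if "x \<in> ?T" for x
      using that by (simp add: \<Phi>)
    then show ?thesis by blast
  qed
  have "quotient_map (ctop ?Q) (ctop Y) \<Phi>"
    unfolding quotient_map_def topQ
  proof (intro conjI allI impI)
    show "\<Phi> ` \<pi> ` ?T = topspace (ctop Y)" using \<Phi> surj by (auto simp: image_image)
    show "openin (ctop ?Q) {c \<in> \<pi> ` ?T. \<Phi> c \<in> U} \<longleftrightarrow> openin (ctop Y) U"
      if "U \<subseteq> topspace (ctop Y)" for U
      unfolding openin_quotient_space pre using top[OF that] by auto
  qed
  moreover have "inj_on \<Phi> (topspace (ctop ?Q))"
    unfolding topQ by (auto simp: inj_on_def \<Phi> fibres)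
  moreover have "f \<in> hol Y W \<longleftrightarrow> f \<circ> \<Phi> \<in> hol ?Q {c \<in> topspace (ctop ?Q). \<Phi> c \<in> W}"
    if W: "openin (ctop Y) W" for W f
  proof -
    have "f \<circ> \<Phi> \<in> hol ?Q {c \<in> topspace (ctop ?Q). \<Phi> c \<in> W} \<longleftrightarrow>
        f \<circ> \<Phi> \<circ> \<pi> \<in> hol X {x \<in> ?T. \<psi> x \<in> W}"
      unfolding topQ by (simp add: quotient_space_def pre[simplified] o_assoc)
    also have "\<dots> \<longleftrightarrow> f \<circ> \<psi> \<in> hol X {x \<in> ?T. \<psi> x \<in> W}"
      using local[of "{x \<in> ?T. \<psi> x \<in> W}" "f \<circ> \<psi>" "f \<circ> \<Phi> \<circ> \<pi>"]
        local[of "{x \<in> ?T. \<psi> x \<in> W}" "f \<circ> \<Phi> \<circ> \<pi>" "f \<circ> \<psi>"] \<Phi> by auto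
    finally show ?thesis using hol[OF W] by blast
  qed
  ultimately have "biholomorphism ?Q Y \<Phi>"
    unfolding biholomorphism_def homeomorphic_map_def by blast
  then show ?thesis unfolding biholomorphic_def by blast
qed

lemma biholomorphic_level_quotient:
  fixes p q :: "'k::finite"
  assumes pq: "p \<noteq> q"
  shows "biholomorphic (symplectic_quotient p q)
    (open_subspace (hilb TYPE('k option)) (hilb_nonlinear TYPE('k option)))"
proof -
  let ?H = "hilb TYPE('k option)" and ?N = "hilb_nonlinear TYPE('k option)"
  have emb: "ctop (embedded_space (level_set p q)) = top_of_set (level_set p q)"
    "hol (embedded_space (level_set p q)) = induced_hol id"
    by (simp_all add: embedded_space_def)
  have N: "?N \<subseteq> topspace (ctop ?H)" using openin_nonlinear[OF pq] openin_subset by blast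
  have sub: "ctop (open_subspace ?H ?N) = subtopology (ctop ?H) ?N" "hol (open_subspace ?H ?N) = hol ?H"
    by (simp_all add: open_subspace_def)
  have topN: "topspace (ctop (open_subspace ?H ?N)) = ?N"
    using N by (auto simp: sub)
  have openN: "openin (ctop (open_subspace ?H ?N)) W \<longleftrightarrow> openin (ctop ?H) W" if "W \<subseteq> ?N" for W
    using that openin_open_subtopology[OF openin_nonlinear[OF pq]] by (simp add: sub)
  show ?thesis
    unfolding symplectic_quotient_def
  proof (rule biholomorphic_quotient_spaceI[where \<psi> = "level_ideal p q"])
    show "openin (ctop (embedded_space (level_set p q)))
        {x \<in> topspace (ctop (embedded_space (level_set p q))). level_ideal p q x \<in> W} \<longleftrightarrow>
      openin (ctop (open_subspace ?H ?N)) W"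
      if "W \<subseteq> topspace (ctop (open_subspace ?H ?N))" for W
      using that openin_level_preimage[OF pq] openN unfolding topN by (simp add: emb)
    show "f \<in> hol (open_subspace ?H ?N) W \<longleftrightarrow> f \<circ> level_ideal p q \<in> hol (embedded_space (level_set p q))
        {x \<in> topspace (ctop (embedded_space (level_set p q))). level_ideal p q x \<in> W}"
      if "openin (ctop (open_subspace ?H ?N)) W" for W f
      using openin_subset[OF that] hol_level_preimage[OF pq] unfolding topN by (simp add: emb sub)
    show "g \<in> hol (embedded_space (level_set p q)) W"
      if "\<And>x. x \<in> W \<Longrightarrow> f x = g x" "f \<in> hol (embedded_space (level_set p q)) W"
      for W and f g :: "'k matpair \<Rightarrow> complex"
      using that unfolding emb induced_hol_def by simp
  qed (use level_ideal_surj[OF pq] orbit_eq_iff[OF pq] topN in \<open>simp_all add: emb\<close>)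
qed

theorem theorem1p10:
  fixes p q :: "'k :: finite"
  assumes "CARD('k) \<ge> 2" and "p \<noteq> q"
  shows "group_action (hatG0 p q) (level_set p q) (level_act p q) \<and>
    free_action (hatG0 p q) (level_set p q) (level_act p q) \<and>
    proper_action (hatG0 p q) (level_set p q) (level_act p q) \<and>
    openin (ctop (hilb TYPE('k option))) (hilb_nonlinear TYPE('k option)) \<and>
    biholomorphic (symplectic_quotient p q)
      (open_subspace (hilb TYPE('k option)) (hilb_nonlinear TYPE('k option)))"
  using assms(2)
  by (simp add: group_action_level free_action_level proper_action_level openin_nonlinear
      biholomorphic_level_quotient)

end
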